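(* For all integers $\alpha\ge 0$ and $n\ge 0$, \[ a\bigl(5^{2\alpha+2}n+\delta_\alpha\bigr)\equiv 0 \pmod{5^{\alpha+1}}, \] where $\delta_\alpha$ is the integer with $0\le \delta_\alpha<5^{2\alpha+2}$ and $8\delta_\alpha\equiv 1 \pmod{5^{2\alpha+2}}$.
   Context: The cubic partition function $a(n)$ is defined by $\sum_{n\ge 0}a(n)q^n=\prod_{n\ge 1}\frac{1}{(1-q^n)(1-q^{2n})}$. *)

theory Defs
  imports "HOL-Computational_Algebra.Formal_Power_Series" "HOL-Number_Theory.Cong"
begin

text \<open>Generating function of the cubic partition function:
  prod_{k>=1} 1/((1-q^k)(1-q^(2k))), truncated at k = N (factors with k > N do
  not affect coefficients of q^m for m <= N). Computed over the rationals.\<close>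

definition cubic_gf :: "nat \<Rightarrow> rat fps" where
  "cubic_gf N = (\<Prod>k\<in>{1..N}. inverse ((1 - fps_X ^ k) * (1 - fps_X ^ (2 * k))))"

definition cubic_partition :: "nat \<Rightarrow> int" where
  "cubic_partition n = (THE a. of_int a = fps_nth (cubic_gf n) n)"

end

theory Submission
  imports Defs "HOL-Computational_Algebra.Formal_Laurent_Series" Complex_Main
begin

unbundle fps_syntax

text \<open>
  Write f_k for the product of the factors 1 - q^(kn), n \<ge> 1, and
  F = q^3 f_25 f_50 / (f_1 f_2), t = q f_5^2 f_10^2 / (f_1^2 f_2^2).  Let U keep the exponents
  divisible by 5 and divide them by 5.  Then y = 1 / (f_1 f_2) is the generating function, and
  f_1 f_2 U(U(q^3 y)) = U(U(F f_1 f_2 y)), so the congruences follow by iterating U(F x) and U(x)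
  on polynomials x in t; F and t are invariant under the Atkin--Lehner involution at 2, which swaps
  f_1 with f_2 and f_5 with f_10 up to constants, so that one function t suffices at level 10.

  Since F^2 = t(q) t(q^5), everything is governed by the values U(F^m), which satisfy a linear
  recurrence once F is known to satisfy an equation of degree 5 over the polynomials in t(q^5).
  That equation comes from the 5-dissections f_1 = q f_25 (u - 1 - 1/u),
  f_2 = q^2 f_50 (v - 1 - 1/v).  Comparing residue classes of exponents in
  f_1^2 = f_2 (1 + 2 \<Sum> (-1)^n q^(n^2)), where squares avoid the classes 2 and 3 modulo 5, yields both
  the reciprocity of the two outer terms in each dissection and the relation between the Rogers--Ramanujan type series u and v,
  parametrised by a = u v^2.  The norm of f_1 over the fifth roots of unity expresses t(q^5) in a.

  5-adically, the span of 5^w t^j with j \<ge> 1 and 5(j - 1) \<le> 3w + 2 contains U(F), is mapped to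
  itself by x \<mapsto> U(F x), and is mapped into 5 times itself by U.
\<close>

subsection \<open>The pentagonal number theorem and Gauss's square series\<close>

text \<open>Up to the factor q^(1/8), f_1 f_2 is eta(z) eta(2z). This one exponent explains both
  constants: q^3 in F is q^(25/8 - 1/8), and the congruence 8\<delta> \<equiv> 1 describes the
  exponents that the iteration retains. Everything is done with formal series. Identities that are
  usually checked by counting zeros and poles are reduced to two theta series, each the limit of a
  finite telescoping sum, and to identities between rational functions of a. The norms of f_1 and
  f_2 multiply to a cube, so they determine t(q^5) only up to a cube root of unity; leading
  coefficients settle that choice. The 5-adic gain comes from parity. Because t^j = F^(2j) /
  t(q^5)^j, U(F t^j) involves U(F^(2j+1)), whereas U(t^j) involves U(F^(2j)). A single factor F is
  worth weight 3 in the estimates, which is exactly one factor 5; so x \<mapsto> U(F x) only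
  preserves the span, and U alone gains the factor.\<close>

definition alt_sign :: "int \<Rightarrow> 'a::comm_ring_1" where
  "alt_sign j = (if even j then 1 else -1)"

lemma sum_symmetric_Suc:
  fixes g :: "int \<Rightarrow> 'a::comm_monoid_add"
  shows "(\<Sum>j\<in>{- int (Suc n)..int (Suc n)}. g j) = (\<Sum>j\<in>{- int n..int n}. g j) + (g (int (Suc n)) + g (- int (Suc n)))"
proof -
  have "{- int (Suc n)..int (Suc n)} = insert (int (Suc n)) (insert (- int (Suc n)) {- int n..int n})"
    by auto
  thus ?thesis by (simp add: add_ac)
qed

lemma alt_sign_int: "alt_sign (int n) = (-1) ^ n" "alt_sign (- int n) = (-1) ^ n"
  by (auto simp: alt_sign_def)

text \<open>The shape "n(n-1) or n^2, plus a triangular number" is what the boundary terms in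
  \<open>shanks_pentagonal\<close> produce. Truncated subtraction at n = 0 is harmless because of
  the factor n.\<close>

lemma pent_nat:
  "nat (int n * (3 * int n - 1) div 2) = n * (n - 1) + n * (n + 1) div 2"
  "nat ((- int n) * (3 * (- int n) - 1) div 2) = n * n + n * (n + 1) div 2"
proof -
  have half: "nat (2 * int m div 2) = m" for m by simp
  have e: "2 * (n * (n + 1) div 2) = n * (n + 1)" by simp
  have i: "int (n * (n - 1)) = int n * int n - int n" 
    by (cases n) (auto simp: algebra_simps)
  have "2 * (n * (n - 1) + n * (n + 1) div 2) = 2 * (n * (n - 1)) + n * (n + 1)"
    by (simp only: distrib_left[of "2::nat" _ "n * (n + 1) div 2"] e)
  hence "2 * int (n * (n - 1) + n * (n + 1) div 2) = 2 * int (n * (n - 1)) + int (n * (n + 1))"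
    by linarith
  hence "int n * (3 * int n - 1) = 2 * int (n * (n - 1) + n * (n + 1) div 2)"
    using i by (simp add: algebra_simps)
  thus "nat (int n * (3 * int n - 1) div 2) = n * (n - 1) + n * (n + 1) div 2"
    by (simp only: half)
  have "2 * (n * n + n * (n + 1) div 2) = 2 * (n * n) + n * (n + 1)"
    by (simp only: distrib_left[of "2::nat" _ "n * (n + 1) div 2"] e)
  hence "2 * int (n * n + n * (n + 1) div 2) = 2 * int (n * n) + int (n * (n + 1))"
    by linarith
  hence "(- int n) * (3 * (- int n) - 1) = 2 * int (n * n + n * (n + 1) div 2)"
    by (simp add: algebra_simps)
  thus "nat ((- int n) * (3 * (- int n) - 1) div 2) = n * n + n * (n + 1) div 2"
    by (simp only: half)
qed

lemma triangular_Suc: "Suc k * (Suc k + 1) div 2 = k * (k + 1) div 2 + Suc k"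
  by simp

text \<open>Shanks's finite form of Euler's theorem. For q = X the summand k = 0 is the truncated
  Euler product and the others have order greater than n. From n to n + 1 each summand changes by a
  telescoping difference, which leaves the two terms j = n + 1 and j = -(n + 1).\<close>

lemma shanks_pentagonal:
  fixes q :: "'a::comm_ring_1"
  shows "(\<Sum>k=0..n. (-1) ^ k * (\<Prod>i\<in>{k+1..n}. 1 - q ^ i) * q ^ (k * n + k * (k + 1) div 2))
       = (\<Sum>j\<in>{- int n..int n}. alt_sign j * q ^ nat (j * (3 * j - 1) div 2))"
proof (induction n)
  case 0
  show ?case by (simp add: alt_sign_def)
next
  case (Suc n)
  define T where "T = (\<lambda>n k. (-1) ^ k * (\<Prod>i\<in>{k+1..n}. 1 - q ^ i) * q ^ (k * n + k * (k + 1) div 2))"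
  \<comment> \<open>The product starts at \<open>k\<close> instead of \<open>k + 1\<close>, so
    \<open>D 0\<close> contains the factor 1 - q^0 = 0 and the lower end of the telescoping sum
    vanishes.\<close>
  define D where "D = (\<lambda>k. (-1) ^ k * (\<Prod>i\<in>{k..n}. 1 - q ^ i) * q ^ (k * n + k * (k + 1) div 2))"
  have step: "T (Suc n) k = T n k + (D (Suc k) - D k)" if "k \<le> n" for k
  proof -
    have 1: "(\<Prod>i\<in>{k+1..Suc n}. 1 - q ^ i) = (\<Prod>i\<in>{k+1..n}. 1 - q ^ i) * (1 - q ^ Suc n)"
      using that by simp
    have 2: "(\<Prod>i\<in>{k..n}. 1 - q ^ i) = (1 - q ^ k) * (\<Prod>i\<in>{k+1..n}. 1 - q ^ i)"
      using that by (simp add: prod.atLeast_Suc_atMost)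
    have 3: "Suc k * n + Suc k * (Suc k + 1) div 2 = (k * n + k * (k + 1) div 2) + n + Suc k"
      by (subst triangular_Suc) simp
    have 4: "k * Suc n + k * (k + 1) div 2 = (k * n + k * (k + 1) div 2) + k" by simp
    have alg: "s * (P * (1 - q ^ Suc n)) * q ^ (m + k)
             = s * P * q ^ m + (- s * P * q ^ (m + n + Suc k) - s * ((1 - q ^ k) * P) * q ^ m)" for s P :: 'a and m
      by (simp add: power_add algebra_simps)
    show ?thesis
      unfolding T_def D_def 1 2 3 4 using alg by simp
  qed
  have "(\<Sum>k=0..Suc n. T (Suc n) k) = (\<Sum>k=0..n. T n k) + (\<Sum>k=0..n. D (Suc k) - D k) + T (Suc n) (Suc n)"
    using step by (simp add: sum.distrib)
  also have "(\<Sum>k=0..n. D (Suc k) - D k) = D (Suc n) - D 0"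
    by (rule sum_Suc_diff) simp
  finally have S: "(\<Sum>k=0..Suc n. T (Suc n) k) = (\<Sum>k=0..n. T n k) + (D (Suc n) - D 0) + T (Suc n) (Suc n)" .
  have "(\<Prod>i\<in>{0..n}. 1 - q ^ i) = 0" by (rule prod_zero) (simp_all, rule bexI[of _ 0], simp_all)
  hence "D 0 = 0" by (simp only: D_def) simp
  with S have "(\<Sum>k=0..Suc n. T (Suc n) k) = (\<Sum>k=0..n. T n k) + (D (Suc n) + T (Suc n) (Suc n))" 
    by (simp add: algebra_simps)
  moreover have "D (Suc n) = alt_sign (int (Suc n)) * q ^ nat (int (Suc n) * (3 * int (Suc n) - 1) div 2)"
    unfolding pent_nat alt_sign_int D_def by simp
  moreover have "T (Suc n) (Suc n) = alt_sign (- int (Suc n)) * q ^ nat ((- int (Suc n)) * (3 * (- int (Suc n)) - 1) div 2)"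
    unfolding pent_nat alt_sign_int T_def by simp
  ultimately show ?case
    using Suc.IH unfolding sum_symmetric_Suc T_def by simp
qed

text \<open>The same method for Gauss's series. \<open>r i\<close> plays the role of 1/(1 + q^i), so
  \<open>2 * r 0 = 1\<close> and the summand k = 0 is the product of (1 - q^i)/(1 + q^i).\<close>

lemma shanks_gauss:
  fixes q :: "'a::comm_ring_1"
  assumes r: "\<And>i. r i * (1 + q ^ i) = 1"
  shows "(\<Sum>k=0..n. (-1) ^ k * (\<Prod>i\<in>{k+1..n}. (1 - q ^ i) * r i) * (2 * r k * q ^ (k * (n + 1))))
       = (\<Sum>j\<in>{- int n..int n}. alt_sign j * q ^ nat (j * j))"
proof (induction n)
  case 0
  show ?case using r[of 0] by (simp add: alt_sign_def mult_ac)
next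
  case (Suc n)
  define T where "T = (\<lambda>n k. (-1) ^ k * (\<Prod>i\<in>{k+1..n}. (1 - q ^ i) * r i) * (2 * r k * q ^ (k * (n + 1))))"
  define D where "D = (\<lambda>k. (-1) ^ k * (\<Prod>i\<in>{k..n}. (1 - q ^ i) * r i) * (2 * r (Suc n) * q ^ (k * (n + 1))))"
  have step: "T (Suc n) k = T n k + (D (Suc k) - D k)" if "k \<le> n" for k
  proof -
    have 1: "(\<Prod>i\<in>{k+1..Suc n}. (1 - q ^ i) * r i) = (\<Prod>i\<in>{k+1..n}. (1 - q ^ i) * r i) * ((1 - q ^ Suc n) * r (Suc n))"
      using that by simp
    have 2: "(\<Prod>i\<in>{k..n}. (1 - q ^ i) * r i) = (1 - q ^ k) * r k * (\<Prod>i\<in>{k+1..n}. (1 - q ^ i) * r i)"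
      using that by (simp add: prod.atLeast_Suc_atMost)
    define A where "A = (-1) ^ k * (\<Prod>i\<in>{k+1..n}. (1 - q ^ i) * r i) * q ^ (k * (n + 1))"
    define x where "x = q ^ k"
    define y where "y = q ^ Suc n"
    define R where "R = r k"
    define S where "S = r (Suc n)"
    \<comment> \<open>The only relations needed: they eliminate q^k and q^(n+1) in favour of the two
      reciprocals, after which the step is polynomial.\<close>
    have R: "R * x = 1 - R" using r[of k] by (simp add: R_def x_def algebra_simps)
    have S: "S * y = 1 - S" using r[of "Suc n"] by (simp add: S_def y_def algebra_simps)
    have t1: "T (Suc n) k = A * 2 * ((1 - y) * S * R * x)"
      unfolding T_def 1 A_def x_def y_def R_def S_def by (simp add: power_add algebra_simps)
    have t2: "T n k = A * 2 * R"
      unfolding T_def A_def R_def by (simp add: algebra_simps)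
    have t3: "D (Suc k) = - (A * 2 * (S * y))"
      unfolding D_def A_def S_def y_def by (simp add: power_add algebra_simps)
    have t4: "D k = A * 2 * ((1 - x) * R * S)"
      unfolding D_def 2 A_def S_def x_def R_def by (simp add: algebra_simps)
    have "(1 - y) * S * R * x = (S - S * y) * (R * x)" by (simp add: algebra_simps)
    also have "\<dots> = (2 * S - 1) * (1 - R)" unfolding R S by (simp add: algebra_simps)
    finally have e1: "(1 - y) * S * R * x = (2 * S - 1) * (1 - R)" .
    have "(1 - x) * R * S = (R - R * x) * S" by (simp add: algebra_simps)
    also have "\<dots> = (2 * R - 1) * S" unfolding R by (simp add: algebra_simps)
    finally have e2: "(1 - x) * R * S = (2 * R - 1) * S" .
    show ?thesis unfolding t1 t2 t3 t4 e1 e2 S by (simp add: algebra_simps)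
  qed
  have "(\<Sum>k=0..Suc n. T (Suc n) k) = (\<Sum>k=0..n. T n k) + (\<Sum>k=0..n. D (Suc k) - D k) + T (Suc n) (Suc n)"
    using step by (simp add: sum.distrib)
  also have "(\<Sum>k=0..n. D (Suc k) - D k) = D (Suc n) - D 0"
    by (rule sum_Suc_diff) simp
  finally have S: "(\<Sum>k=0..Suc n. T (Suc n) k) = (\<Sum>k=0..n. T n k) + (D (Suc n) - D 0) + T (Suc n) (Suc n)" .
  have "(\<Prod>i\<in>{0..n}. (1 - q ^ i) * r i) = 0" by (rule prod_zero) (simp_all, rule bexI[of _ 0], simp_all)
  hence "D 0 = 0" by (simp only: D_def) simp
  with S have *: "(\<Sum>k=0..Suc n. T (Suc n) k) = (\<Sum>k=0..n. T n k) + (D (Suc n) + T (Suc n) (Suc n))" 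
    by (simp add: algebra_simps)
  have "D (Suc n) + T (Suc n) (Suc n)
     = (-1) ^ Suc n * 2 * q ^ (Suc n * Suc n) * (r (Suc n) * (1 + q ^ Suc n))"
    unfolding D_def T_def by (simp add: power_add algebra_simps)
  also have "\<dots> = alt_sign (int (Suc n)) * q ^ nat (int (Suc n) * int (Suc n))
       + alt_sign (- int (Suc n)) * q ^ nat ((- int (Suc n)) * (- int (Suc n)))"
    unfolding r alt_sign_int by (simp add: nat_mult_distrib flip: of_nat_Suc)
  finally show ?case
    using Suc.IH * unfolding sum_symmetric_Suc T_def by simp
qed

section \<open>Truncated products and the passage to the limit\<close>

definition euler_trunc :: "nat \<Rightarrow> 'a::comm_ring_1 fps" where
  "euler_trunc N = (\<Prod>k\<in>{1..N}. 1 - fps_X ^ k)"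

text \<open>The infinite product f_1, read off coefficientwise: factors beyond the n-th do not touch
  the n-th coefficient, so no notion of convergence is involved.\<close>

definition euler :: "'a::comm_ring_1 fps" where
  "euler = Abs_fps (\<lambda>n. euler_trunc n $ n)"

text \<open>Congruence modulo X^(n+1), used to carry identities from truncated products over to
  \<open>euler\<close>.\<close>

definition eqmod :: "nat \<Rightarrow> 'a::comm_ring_1 fps \<Rightarrow> 'a fps \<Rightarrow> bool" where
  "eqmod n f g \<longleftrightarrow> (\<forall>i\<le>n. f $ i = g $ i)"

lemma eqmod_refl [simp]: "eqmod n f f" by (simp add: eqmod_def)
lemma eqmod_sym: "eqmod n f g \<Longrightarrow> eqmod n g f" by (simp add: eqmod_def)
lemma eqmod_trans: "eqmod n f g \<Longrightarrow> eqmod n g h \<Longrightarrow> eqmod n f h" by (simp add: eqmod_def)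

lemma eqmod_mult: "eqmod n f g \<Longrightarrow> eqmod n h k \<Longrightarrow> eqmod n (f * h) (g * k)"
  by (auto simp: eqmod_def fps_mult_nth intro!: sum.cong)

lemma eqmod_power: "eqmod n f g \<Longrightarrow> eqmod n (f ^ k) (g ^ k)"
  by (induction k) (auto intro: eqmod_mult)

lemma eqmod_imp_eq: "(\<And>n. eqmod n f g) \<Longrightarrow> f = g"
  by (auto simp: eqmod_def fps_eq_iff)

lemma eqmod_compose_X_power:
  assumes "eqmod n f g" "d > 0"
  shows "eqmod n (f oo fps_X ^ d) (g oo fps_X ^ d)"
  using assms by (auto simp: eqmod_def fps_nth_compose_X_power intro: order.trans[OF div_le_dividend])

lemma eqmod_1_minus_X_power: "n < k \<Longrightarrow> eqmod n (1 - fps_X ^ k) 1"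
  by (auto simp: eqmod_def fps_X_power_nth)

lemma euler_trunc_Suc: "euler_trunc (Suc N) = euler_trunc N * (1 - fps_X ^ Suc N)"
  by (simp add: euler_trunc_def)

lemma eqmod_euler_trunc: "n \<le> N \<Longrightarrow> eqmod n (euler_trunc N :: 'a::comm_ring_1 fps) (euler_trunc n)"
proof (induction N rule: dec_induct)
  case (step N)
  have "eqmod n (euler_trunc N * (1 - fps_X ^ Suc N)) (euler_trunc n * 1 :: 'a fps)"
    using step by (intro eqmod_mult eqmod_1_minus_X_power) auto
  thus ?case by (simp add: euler_trunc_Suc)
qed simp

lemma eqmod_euler: "n \<le> N \<Longrightarrow> eqmod n euler (euler_trunc N :: 'a::comm_ring_1 fps)"
proof -
  assume nN: "n \<le> N"
  show ?thesis
    unfolding eqmod_def euler_def fps_nth_Abs_fps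
  proof (intro allI impI)
    fix i assume "i \<le> n"
    with nN have "eqmod i (euler_trunc N :: 'a fps) (euler_trunc i)" by (intro eqmod_euler_trunc) auto
    thus "euler_trunc i $ i = (euler_trunc N :: 'a fps) $ i"
      unfolding eqmod_def by fastforce
  qed
qed

lemma euler_nth_0 [simp]: "euler $ 0 = 1"
  by (simp add: euler_def euler_trunc_def)

text \<open>Guarantees that the finite range -n..n of Shanks's sum already contains every index
  whose pentagonal number is at most n; likewise that the index sets in
  \<open>euler_pentagonal\<close> are finite.\<close>

lemma pent_bound: "\<bar>j\<bar> \<le> j * (3 * j - 1) div 2" for j :: int
proof -
  have "2 * \<bar>j\<bar> \<le> j * (3 * j - 1)"
  proof (cases "j \<ge> 0")
    case True
    show ?thesis
    proof (cases "j = 0")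
      case False
      hence "j * 2 \<le> j * (3 * j - 1)" using True by (intro mult_left_mono) auto
      thus ?thesis using True by simp
    qed auto
  next
    case False
    hence "(-j) * 2 \<le> (-j) * (1 - 3 * j)" by (intro mult_left_mono) auto
    thus ?thesis using False by (simp add: algebra_simps)
  qed
  thus ?thesis by linarith
qed

lemma fps_sum_power_nth:
  fixes p :: "int \<Rightarrow> nat"
  assumes "finite A"
  shows "(\<Sum>j\<in>A. alt_sign j * fps_X ^ p j :: 'a::comm_ring_1 fps) $ e = (\<Sum>j\<in>{j\<in>A. p j = e}. alt_sign j)"
proof -
  have s: "(alt_sign j * fps_X ^ p j :: 'a::comm_ring_1 fps) $ e = (if p j = e then alt_sign j else 0)" for j
    by (auto simp: alt_sign_def fps_X_power_nth)
  show ?thesis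
    by (simp add: fps_sum_nth s sum.inter_filter[OF assms])
qed

theorem euler_pentagonal:
  "(euler :: 'a::comm_ring_1 fps) $ e = (\<Sum>j\<in>{j. j * (3 * j - 1) = 2 * int e}. alt_sign j)"
proof -
  define n where "n = e"
  let ?T = "\<lambda>k. (-1) ^ k * (\<Prod>i\<in>{k+1..n}. 1 - fps_X ^ i) * fps_X ^ (k * n + k * (k + 1) div 2) :: 'a fps"
  have 0: "?T k $ e = 0" if "k \<in> {1..n}" for k
  proof -
    have "k * (k + 1) div 2 \<ge> 1" "k * n \<ge> 1 * n" 
      using that div_le_mono[of 2 "k * (k + 1)" 2] mult_le_mono[of 1 k 2 "k+1"] 
      by (auto simp del: One_nat_def simp: Suc_le_eq)
    hence "e < k * n + k * (k + 1) div 2" unfolding n_def by linarith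
    thus ?thesis by (simp add: fps_X_power_mult_right_nth)
  qed
  have "(euler :: 'a fps) $ e = euler_trunc n $ e"
    using eqmod_euler[of n n] by (auto simp: eqmod_def n_def)
  also have "\<dots> = ?T 0 $ e" by (simp add: euler_trunc_def)
  also have "\<dots> = (\<Sum>k=0..n. ?T k) $ e"
    unfolding fps_sum_nth by (subst sum.atLeast_Suc_atMost) (use 0 in \<open>auto intro!: sum.neutral\<close>)
  also have "\<dots> = (\<Sum>j\<in>{j\<in>{- int n..int n}. nat (j * (3 * j - 1) div 2) = e}. alt_sign j)"
    unfolding shanks_pentagonal by (rule fps_sum_power_nth) simp
  also have "{j\<in>{- int n..int n}. nat (j * (3 * j - 1) div 2) = e} = {j. j * (3 * j - 1) = 2 * int e}"
  proof (intro equalityI subsetI)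
    fix j assume j: "j \<in> {j\<in>{- int n..int n}. nat (j * (3 * j - 1) div 2) = e}"
    have "even (j * (3 * j - 1))" by (cases "even j") auto
    moreover have "j * (3 * j - 1) div 2 = int e" using j pent_bound[of j] by auto
    ultimately have "j * (3 * j - 1) = 2 * int e"
      by (metis dvd_mult_div_cancel)
    thus "j \<in> {j. j * (3 * j - 1) = 2 * int e}" by blast
  next
    fix j assume j: "j \<in> {j. j * (3 * j - 1) = 2 * int e}"
    thus "j \<in> {j\<in>{- int n..int n}. nat (j * (3 * j - 1) div 2) = e}"
      using pent_bound[of j] by (auto simp: n_def)
  qed
  finally show ?thesis .
qed

definition phi :: "'a::comm_ring_1 fps" where
  "phi = Abs_fps (\<lambda>e. \<Sum>j\<in>{j. j * j = int e}. alt_sign j)"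

text \<open>Gauss's identity makes \<open>phi\<close> the product of (1 - q^i)/(1 + q^i). Since (1 -
  q^i)(1 + q^i) = 1 - q^(2i), multiplication by f_2 clears the denominators and leaves
  f_1^2.\<close>

theorem euler_squared: "(euler :: complex fps)\<^sup>2 = phi * (euler oo fps_X ^ 2)"
proof (rule eqmod_imp_eq)
  fix n
  define r :: "nat \<Rightarrow> complex fps" where "r = (\<lambda>i. inverse (1 + fps_X ^ i))"
  have r: "r i * (1 + fps_X ^ i) = 1" for i
    unfolding r_def by (rule inverse_mult_eq_1) (auto simp: fps_X_power_nth)
  let ?T = "\<lambda>k. (-1) ^ k * (\<Prod>i\<in>{k+1..n}. (1 - fps_X ^ i) * r i) * (2 * r k * fps_X ^ (k * (n + 1)))"
  have r0: "2 * r 0 = 1" using r[of 0] by (simp add: mult.commute)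
  have 0: "?T k $ e = 0" if "k \<in> {1..n}" "e \<le> n" for k e
  proof -
    have "e < 1 * (n + 1)" using that by simp
    also have "\<dots> \<le> k * (n + 1)" using that by (intro mult_le_mono1) auto
    finally have "e < k * (n + 1)" .
    thus ?thesis unfolding mult.assoc[symmetric] by (simp add: fps_X_power_mult_right_nth del: mult_Suc_right)
  qed
  have eqphi: "eqmod n phi (?T 0)"
    unfolding eqmod_def
  proof (intro allI impI)
    fix e assume e: "e \<le> n"
    have "?T 0 $ e = (\<Sum>k=0..n. ?T k) $ e"
      unfolding fps_sum_nth by (subst sum.atLeast_Suc_atMost) (use 0 e in \<open>auto intro!: sum.neutral\<close>)
    also have "\<dots> = (\<Sum>j\<in>{j\<in>{- int n..int n}. nat (j * j) = e}. alt_sign j)"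
      unfolding shanks_gauss[OF r] by (rule fps_sum_power_nth) simp
    also have "{j\<in>{- int n..int n}. nat (j * j) = e} = {j. j * j = int e}"
    proof -
      have "\<bar>j\<bar> \<le> j * j" for j :: int
      proof (cases "j = 0")
        case False
        hence "\<bar>j\<bar> * 1 \<le> \<bar>j\<bar> * \<bar>j\<bar>" by (intro mult_left_mono) auto
        thus ?thesis by simp
      qed auto
      note b = this
      have "nat (j * j) = e \<longleftrightarrow> j * j = int e" for j :: int
        by (subst nat_eq_iff) auto
      moreover have "j \<in> {- int n..int n}" if "j * j = int e" for j
      proof -
        have "\<bar>j\<bar> \<le> int n" using b[of j] that e by linarith
        thus ?thesis by auto
      qed
      ultimately show ?thesis by (intro Collect_cong) metis
    qed
    finally show "(phi :: complex fps) $ e = ?T 0 $ e" by (simp add: phi_def)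
  qed
  have e: "eqmod n euler (euler_trunc n)" by (rule eqmod_euler) simp
  have "eqmod n (phi * (euler oo fps_X ^ 2)) (?T 0 * (euler_trunc n oo fps_X ^ 2))"
    by (intro eqmod_mult eqphi eqmod_compose_X_power e) simp
  also have "?T 0 * (euler_trunc n oo fps_X ^ 2) = (\<Prod>i\<in>{1..n}. (1 - fps_X ^ i) * r i) * (\<Prod>i\<in>{1..n}. 1 - fps_X ^ (2 * i))"
  proof -
    have "(euler_trunc n oo fps_X ^ 2 :: complex fps) = (\<Prod>i\<in>{1..n}. (1 - fps_X ^ i) oo fps_X ^ 2)"
      unfolding euler_trunc_def by (rule fps_compose_prod_distrib) simp
    also have "\<dots> = (\<Prod>i\<in>{1..n}. 1 - fps_X ^ (2 * i))"
      by (simp add: fps_compose_sub_distrib fps_X_power_compose power_mult)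
    finally have *: "(euler_trunc n oo fps_X ^ 2 :: complex fps) = (\<Prod>i\<in>{1..n}. 1 - fps_X ^ (2 * i))" .
    show ?thesis unfolding * by (simp add: r0)
  qed
  also have "\<dots> = (\<Prod>i\<in>{1..n}. ((1 - fps_X ^ i) * r i) * (1 - fps_X ^ (2 * i)))"
    by (rule prod.distrib [symmetric])
  also have "\<dots> = (\<Prod>i\<in>{1..n}. (1 - fps_X ^ i)\<^sup>2)"
  proof (intro prod.cong refl)
    fix i
    have "((1 - x) * y) * (1 - x\<^sup>2) = (1 - x)\<^sup>2 * (y * (1 + x))" for x y :: "complex fps"
      by (simp add: power2_eq_square algebra_simps)
    from this[of "fps_X ^ i" "r i"]
    show "((1 - fps_X ^ i) * r i) * (1 - fps_X ^ (2 * i)) = (1 - fps_X ^ i)\<^sup>2"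
      unfolding r mult.commute[of 2 i] power_mult by (simp only: mult_1_right)
  qed
  also have "\<dots> = (euler_trunc n)\<^sup>2" by (simp add: euler_trunc_def prod_power_distrib)
  finally have *: "eqmod n (phi * (euler oo fps_X ^ 2)) ((euler_trunc n)\<^sup>2 :: complex fps)" .
  show "eqmod n ((euler :: complex fps)\<^sup>2) (phi * (euler oo fps_X ^ 2))"
    by (rule eqmod_trans[OF eqmod_power[OF e] eqmod_sym[OF *]])
qed

subsection \<open>Residue classes of exponents modulo 5\<close>

text \<open>Indices are compared modulo 5, so they add under multiplication and may be negative; the
  zero series belongs to every class.\<close>

definition graded :: "int \<Rightarrow> 'a::zero fls \<Rightarrow> bool" where
  "graded i f \<longleftrightarrow> (\<forall>n. f $$ n \<noteq> 0 \<longrightarrow> n mod 5 = i mod 5)"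

lemma graded_add [intro]: "graded i f \<Longrightarrow> graded i g \<Longrightarrow> graded i (f + g)"
  for f :: "'a::monoid_add fls"
  unfolding graded_def by (metis add_0 fls_plus_nth)

lemma graded_diff [intro]: "graded i f \<Longrightarrow> graded i g \<Longrightarrow> graded i (f - g)"
  for f :: "'a::group_add fls"
  unfolding graded_def by (metis diff_0_right fls_minus_nth)

lemma graded_uminus [intro]: "graded i f \<Longrightarrow> graded i (- f)"
  for f :: "'a::group_add fls"
  by (auto simp: graded_def)

lemma graded_mult:
  fixes f g :: "'a::semiring_0 fls"
  assumes "graded i f" "graded j g"
  shows "graded (i + j) (f * g)"
  unfolding graded_def
proof (intro allI impI)
  fix n assume "(f * g) $$ n \<noteq> 0"
  hence "(\<Sum>k=fls_subdegree f..n - fls_subdegree g. f $$ k * g $$ (n - k)) \<noteq> 0"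
    by (simp only: fls_times_nth(2) not_False_eq_True)
  then obtain k where "f $$ k * g $$ (n - k) \<noteq> 0"
    by (rule sum.not_neutral_contains_not_neutral)
  hence "f $$ k \<noteq> 0" "g $$ (n - k) \<noteq> 0" by auto
  hence "k mod 5 = i mod 5" "(n - k) mod 5 = j mod 5" using assms by (auto simp: graded_def)
  hence "(k + (n - k)) mod 5 = (i + j) mod 5" by (rule mod_add_cong)
  thus "n mod 5 = (i + j) mod 5" by simp
qed

lemma graded_mult': "graded i f \<Longrightarrow> graded j g \<Longrightarrow> k mod 5 = (i + j) mod 5 \<Longrightarrow> graded k (f * g)"
  for f g :: "'a::semiring_0 fls"
  using graded_mult[of i f j g] by (simp add: graded_def)

lemma graded_const [intro]: "graded 0 (fls_const c)"
  by (auto simp: graded_def)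

lemma graded_1 [intro]: "graded 0 (1 :: 'a::zero_neq_one fls)"
  by (auto simp: graded_def)

lemma graded_numeral [intro]: "graded 0 (numeral k :: 'a::comm_ring_1 fls)"
  by (metis fls_const_numeral graded_const)

lemma graded_numeral_mult [intro]: "graded i f \<Longrightarrow> graded i (numeral k * f)"
  for f :: "'a::comm_ring_1 fls"
  using graded_mult'[OF graded_numeral] by fastforce

lemma graded_compose_power [intro]: "graded 0 (fls_compose_power f 5)"
  by (auto simp: graded_def fls_nth_compose_power split: if_splits)

lemma graded_unique:
  fixes f :: "int \<Rightarrow> 'a::ab_group_add fls"
  assumes "\<And>i. i \<in> {0..4} \<Longrightarrow> graded i (f i)" "\<And>i. i \<in> {0..4} \<Longrightarrow> graded i (g i)"
  assumes "(\<Sum>i\<in>{0..4}. f i) = (\<Sum>i\<in>{0..4}. g i)" and k: "k \<in> {0..4}"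
  shows "f k = g k"
proof -
  have *: "f k $$ n = (if n mod 5 = k then (\<Sum>i\<in>{0..4}. f i) $$ n else 0)"
    if "\<And>i. i \<in> {0..4} \<Longrightarrow> graded i (f i)" for f :: "int \<Rightarrow> 'a fls" and n
  proof -
    have "f i $$ n = 0" if "i \<in> {0..4}" "n mod 5 \<noteq> i" for i
      using \<open>\<And>i. i \<in> {0..4} \<Longrightarrow> graded i (f i)\<close>[of i] that by (auto simp: graded_def)
    hence 0: "f i $$ n = (if i = n mod 5 then f i $$ n else 0)" if "i \<in> {0..4}" for i
      using that by auto
    have "(\<Sum>i\<in>{0..4}. f i) $$ n = (\<Sum>i\<in>{0..4}. f i $$ n)" by (rule fls_nth_sum)
    also have "\<dots> = (\<Sum>i\<in>{0..4}. if i = n mod 5 then f i $$ n else 0)" 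
      by (intro sum.cong refl 0)
    also have "\<dots> = f (n mod 5) $$ n" by (simp add: sum.delta)
    finally show ?thesis using 0[OF k] by (cases "n mod 5 = k") auto
  qed
  show ?thesis using *[OF assms(1)] *[OF assms(2)] assms(3) by (simp add: fls_eq_iff)
qed

lemma int_interval_0_4: "{0..4::int} = {0, 1, 2, 3, 4}" by auto

lemma graded_unique5:
  fixes f0 :: "'a::ab_group_add fls"
  assumes f: "graded 0 f0" "graded 1 f1" "graded 2 f2" "graded 3 f3" "graded 4 f4"
  assumes g: "graded 0 g0" "graded 1 g1" "graded 2 g2" "graded 3 g3" "graded 4 g4"
  assumes eq: "f0 + f1 + f2 + f3 + f4 = g0 + g1 + g2 + g3 + g4"
  shows "f0 = g0" "f1 = g1" "f2 = g2" "f3 = g3" "f4 = g4"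
proof -
  define h where "h = (\<lambda>a b c d (e :: 'a fls) (i::int). if i = 0 then a else if i = 1 then b else if i = 2 then c else if i = 3 then d else e)"
  have "h f0 f1 f2 f3 f4 k = h g0 g1 g2 g3 g4 k" if "k \<in> {0..4}" for k
  proof (rule graded_unique[OF _ _ _ that])
    show "(\<Sum>i\<in>{0..4}. h f0 f1 f2 f3 f4 i) = (\<Sum>i\<in>{0..4}. h g0 g1 g2 g3 g4 i)"
      using eq by (simp add: int_interval_0_4 h_def add.assoc)
  qed (use f g in \<open>auto simp: h_def int_interval_0_4\<close>)
  from this[of 0] this[of 1] this[of 2] this[of 3] this[of 4]
  show "f0 = g0" "f1 = g1" "f2 = g2" "f3 = g3" "f4 = g4" by (simp_all add: h_def)
qed

section \<open>Pentagonal numbers and squares modulo 5 and 25\<close>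

lemma pent_mod_5:
  fixes j e :: int
  assumes "j * (3 * j - 1) = 2 * e"
  shows "e mod 5 \<in> {0, 1, 2}"
proof -
  \<comment> \<open>3 is the inverse of 2 modulo 5: e is congruent to 6e = 3 j (3j - 1), which
    leaves five residues of j to inspect.\<close>
  have "e mod 5 = (e + 5 * e) mod 5" by (rule mod_mult_self2 [symmetric])
  also have "e + 5 * e = 3 * (j * (3 * j - 1))" using assms by simp
  also have "(3 * (j * (3 * j - 1))) mod 5 = (3 * ((j mod 5) * (3 * (j mod 5) - 1))) mod 5"
    by (intro mod_mult_cong mod_diff_cong refl) simp_all
  finally have e: "e mod 5 = (3 * ((j mod 5) * (3 * (j mod 5) - 1))) mod 5" .
  have "j mod 5 \<in> {0..4}" by simp
  thus ?thesis unfolding e int_interval_0_4 by auto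
qed

text \<open>Only j \<equiv> 1 modulo 5 gives the class 1, and writing j as 1 - 5i (not 1 + 5i) turns
  j(3j - 1) into 2 + 25 i(3i - 1). This self-similarity is why the middle part of the dissection of
  f_1 is again an Euler product.\<close>

lemma pent_mod_25:
  fixes j e :: int
  assumes "j * (3 * j - 1) = 2 * e" "e mod 5 = 1"
  obtains i m where "j = 1 - 5 * i" "e = 25 * m + 1" "i * (3 * i - 1) = 2 * m"
proof -
  have "e mod 5 = (e + 5 * e) mod 5" by (rule mod_mult_self2 [symmetric])
  also have "e + 5 * e = 3 * (j * (3 * j - 1))" using assms by simp
  also have "(3 * (j * (3 * j - 1))) mod 5 = (3 * ((j mod 5) * (3 * (j mod 5) - 1))) mod 5"
    by (intro mod_mult_cong mod_diff_cong refl) simp_all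
  finally have e: "(3 * ((j mod 5) * (3 * (j mod 5) - 1))) mod 5 = 1" using assms(2) by simp
  have "j mod 5 \<in> {0..4}" by simp
  hence "j mod 5 = 1" using e unfolding int_interval_0_4 by auto
  hence "\<exists>i. j = 1 - 5 * i" by presburger
  then obtain i where i: "j = 1 - 5 * i" by blast
  have "even (i * (3 * i - 1))" by simp
  then obtain m where m: "i * (3 * i - 1) = 2 * m" by (elim evenE)
  have "2 * e = 2 + 25 * (i * (3 * i - 1))" using assms(1) unfolding i by (simp add: algebra_simps)
  hence "e = 25 * m + 1" unfolding m by simp
  with i m that show ?thesis by blast
qed

lemma euler_nth_mod_5:
  assumes "e mod 5 = 3 \<or> e mod 5 = 4"
  shows "(euler :: 'a::comm_ring_1 fps) $ e = 0"
proof -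
  have "False" if "j * (3 * j - 1) = 2 * int e" for j
    using pent_mod_5[OF that] assms by (auto simp: zmod_int[symmetric] simp flip: of_nat_mod) presburger+
  hence "{j. j * (3 * j - 1) = 2 * int e} = {}" by blast
  thus ?thesis by (simp add: euler_pentagonal)
qed

text \<open>The minus sign arises because i and 1 - 5i have opposite parities.\<close>

lemma euler_nth_25:
  "(euler :: 'a::comm_ring_1 fps) $ (25 * m + 1) = - euler $ m"
proof -
  let ?g = "\<lambda>i::int. 1 - 5 * i"
  have "{j. j * (3 * j - 1) = 2 * int (25 * m + 1)} = ?g ` {i. i * (3 * i - 1) = 2 * int m}"
  proof (intro equalityI subsetI)
    fix j assume "j \<in> {j. j * (3 * j - 1) = 2 * int (25 * m + 1)}"
    hence j: "j * (3 * j - 1) = 2 * int (25 * m + 1)" by simp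
    have "int (25 * m + 1) mod 5 = 1" by presburger
    from pent_mod_25[OF j this] obtain i k where ik: "j = 1 - 5 * i" "int (25 * m + 1) = 25 * k + 1" 
      "i * (3 * i - 1) = 2 * k" by blast
    hence "k = int m" by simp
    thus "j \<in> ?g ` {i. i * (3 * i - 1) = 2 * int m}" using ik by blast
  next
    fix j assume "j \<in> ?g ` {i. i * (3 * i - 1) = 2 * int m}"
    then obtain i where i: "j = 1 - 5 * i" "i * (3 * i - 1) = 2 * int m" by blast
    have "j * (3 * j - 1) = 2 + 25 * (i * (3 * i - 1))" unfolding i(1) by (simp add: algebra_simps)
    thus "j \<in> {j. j * (3 * j - 1) = 2 * int (25 * m + 1)}" unfolding i(2) by simp
  qed
  moreover have "inj_on ?g S" for S by (auto simp: inj_on_def)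
  ultimately have "(euler :: 'a fps) $ (25 * m + 1) = (\<Sum>i\<in>{i. i * (3 * i - 1) = 2 * int m}. alt_sign (1 - 5 * i))"
    by (simp add: euler_pentagonal sum.reindex)
  also have "\<dots> = (\<Sum>i\<in>{i. i * (3 * i - 1) = 2 * int m}. - alt_sign i)"
    by (intro sum.cong refl) (auto simp: alt_sign_def)
  finally show ?thesis by (simp add: euler_pentagonal sum_negf)
qed

lemma euler_nth_mod_25:
  assumes "e mod 5 = 1" "e mod 25 \<noteq> 1"
  shows "(euler :: 'a::comm_ring_1 fps) $ e = 0"
proof -
  have "False" if j: "j * (3 * j - 1) = 2 * int e" for j
  proof -
    have "int e mod 5 = 1" using assms(1) by presburger
    from pent_mod_25[OF j this] obtain k where "int e = 25 * k + 1" by blast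
    thus False using assms(2) by presburger
  qed
  hence "{j. j * (3 * j - 1) = 2 * int e} = {}" by blast
  thus ?thesis by (simp add: euler_pentagonal)
qed

lemma square_mod_5: "(j * j) mod 5 \<in> {0, 1, 4}" for j :: int
proof -
  have "(j * j) mod 5 = ((j mod 5) * (j mod 5)) mod 5" by (simp add: mod_simps)
  moreover have "j mod 5 \<in> {0..4}" by simp
  ultimately show ?thesis unfolding int_interval_0_4 by auto
qed

lemma phi_nth_mod_5:
  assumes "e mod 5 = 2 \<or> e mod 5 = 3"
  shows "(phi :: 'a::comm_ring_1 fps) $ e = 0"
proof -
  have "False" if "j * j = int e" for j
    using square_mod_5[of j] assms unfolding that by simp presburger
  hence "{j. j * j = int e} = {}" by blast
  thus ?thesis by (simp add: phi_def)
qed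

lemma phi_nth_5:
  "(phi :: 'a::comm_ring_1 fps) $ (5 * m) = (if 5 dvd m then phi $ (m div 5) else 0)"
proof -
  have 5: "5 dvd j" if "j * j = int (5 * m)" for j
  proof -
    have "prime (5::int)" by simp
    moreover have "5 dvd j * j" unfolding that by simp
    ultimately show ?thesis by (metis prime_dvd_mult_iff)
  qed
  show ?thesis
  proof (cases "5 dvd m")
    case True
    then obtain k where k: "m = 5 * k" by blast
    have "{j. j * j = int (5 * m)} = (\<lambda>i. 5 * i) ` {i. i * i = int k}"
      using 5 unfolding k by (fastforce elim!: dvdE)
    hence "(phi :: 'a fps) $ (5 * m) = (\<Sum>i\<in>{i. i * i = int k}. alt_sign (5 * i))"
      unfolding phi_def fps_nth_Abs_fps by (simp only:) (simp add: sum.reindex inj_on_def)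
    thus ?thesis by (simp add: k phi_def alt_sign_def)
  next
    case False
    have "False" if j: "j * j = int (5 * m)" for j
    proof -
      from 5[OF j] obtain i where "j = 5 * i" by blast
      with j have "int m = 5 * (i * i)" by simp
      hence "5 dvd int m" by simp
      thus False using False by presburger
    qed
    hence "{j. j * j = int (5 * m)} = {}" by blast
    thus ?thesis using False by (simp add: phi_def)
  qed
qed

text \<open>The series f_k, as a Laurent series because powers of q will occur in
  denominators.\<close>

definition euler_fls :: "nat \<Rightarrow> complex fls" where
  "euler_fls k = fps_to_fls (euler oo fps_X ^ k)"

definition fps_class :: "nat \<Rightarrow> 'a::zero fps \<Rightarrow> 'a fps" where
  "fps_class i f = Abs_fps (\<lambda>n. if n mod 5 = i then f $ n else 0)"

lemma graded_fps_class: "i < 5 \<Longrightarrow> graded (int i) (fps_to_fls (fps_class i f))"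
  by (auto simp: graded_def fps_class_def nat_mod_as_int split: if_splits)

lemma euler_dissection:
  "(euler :: 'a::idom fps) = fps_class 0 euler - fps_X * (euler oo fps_X ^ 25) + fps_class 2 euler"
proof (rule fps_ext)
  fix n
  show "(euler :: 'a fps) $ n = (fps_class 0 euler - fps_X * (euler oo fps_X ^ 25) + fps_class 2 euler) $ n"
  proof (cases n)
    case (Suc k)
    have "n mod 5 < 5" by simp
    then consider "n mod 5 = 0" | "n mod 5 = 1" | "n mod 5 = 2" | "n mod 5 = 3 \<or> n mod 5 = 4" by linarith
    thus ?thesis
    proof cases
      case 1
      hence "\<not> 25 dvd k" using Suc by presburger
      thus ?thesis using 1 Suc by (simp add: fps_class_def fps_nth_compose_X_power)
    next
      case 2
      show ?thesis
      proof (cases "n mod 25 = 1")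
        case True
        hence "25 dvd k" using Suc by presburger
        then obtain m where "k = 25 * m" by blast
        thus ?thesis using 2 Suc euler_nth_25[of m] by (simp add: fps_class_def fps_nth_compose_X_power)
      next
        case False
        hence "\<not> 25 dvd k" using Suc by presburger
        thus ?thesis using 2 Suc False euler_nth_mod_25[of n, where ?'a = 'a]
          by (simp add: fps_class_def fps_nth_compose_X_power)
      qed
    next
      case 3
      hence "\<not> 25 dvd k" using Suc by presburger
      thus ?thesis using 3 Suc by (simp add: fps_class_def fps_nth_compose_X_power)
    next
      case 4
      hence "\<not> 25 dvd k" using Suc by presburger
      thus ?thesis using 4 Suc euler_nth_mod_5[of n, where ?'a = 'a] 
        by (auto simp add: fps_class_def fps_nth_compose_X_power)
    qed
  qed (simp add: fps_class_def)
qed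

lemma phi_dissection:
  "(phi :: 'a::idom fps) = (phi oo fps_X ^ 25) + fps_class 1 phi + fps_class 4 phi"
proof (rule fps_ext)
  fix n :: nat
  have "n mod 5 < 5" by simp
  then consider "n mod 5 = 0" | "n mod 5 = 1" | "n mod 5 = 4" | "n mod 5 = 2 \<or> n mod 5 = 3" by linarith
  thus "(phi :: 'a fps) $ n = ((phi oo fps_X ^ 25) + fps_class 1 phi + fps_class 4 phi) $ n"
  proof cases
    case 1
    then obtain m where m: "n = 5 * m" by auto
    have "25 dvd 5 * m \<longleftrightarrow> 5 dvd m" "5 * m div 25 = m div 5" by presburger+
    thus ?thesis using m phi_nth_5[of m, where ?'a = 'a] by (simp add: fps_class_def fps_nth_compose_X_power)
  next
    case 2
    hence "\<not> 25 dvd n" by presburger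
    thus ?thesis using 2 by (simp add: fps_class_def fps_nth_compose_X_power)
  next
    case 3
    hence "\<not> 25 dvd n" by presburger
    thus ?thesis using 3 by (simp add: fps_class_def fps_nth_compose_X_power)
  next
    case 4
    hence "\<not> 25 dvd n" by presburger
    thus ?thesis using 4 phi_nth_mod_5[of n, where ?'a = 'a] by (auto simp add: fps_class_def fps_nth_compose_X_power)
  qed
qed

subsection \<open>The 5-dissection of the Euler product\<close>

definition dA :: "complex fls" where "dA = fps_to_fls (fps_class 0 euler)"
definition dB :: "complex fls" where "dB = fps_to_fls (fps_class 2 euler)"
definition dC :: "complex fls" where "dC = fls_X * euler_fls 25"

lemma graded_compose_power_2: "graded i f \<Longrightarrow> graded (2 * i) (fls_compose_power f 2)"
  unfolding graded_def fls_nth_compose_power[OF zero_less_numeral]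
proof (intro allI impI)
  fix n assume f: "\<forall>n. f $$ n \<noteq> 0 \<longrightarrow> n mod 5 = i mod 5" 
    and n: "(if int 2 dvd n then f $$ (n div int 2) else 0) \<noteq> 0"
  then obtain m where m: "n = 2 * m" by (auto split: if_splits)
  with n f have "m mod 5 = i mod 5" by simp
  thus "n mod 5 = (2 * i) mod 5" unfolding m by (intro mod_mult_cong refl)
qed

lemma euler_fls_compose:
  assumes "d > 0" "k > 0"
  shows "fls_compose_power (euler_fls k) d = euler_fls (k * d)"
proof -
  have "(euler oo fps_X ^ k) oo fps_X ^ d = (euler oo fps_X ^ (k * d) :: complex fps)"
    using assms by (intro fps_ext) (auto simp: fps_nth_compose_X_power dvd_div_iff_mult div_mult2_eq mult.commute[of k])
  thus ?thesis using assms by (simp add: euler_fls_def fls_compose_power_fps_to_fls)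
qed

lemma fls_nth_euler_fls_0 [simp]: "euler_fls k $$ 0 = 1"
  by (simp add: euler_fls_def)

lemma euler_fls_nonzero [simp]: "euler_fls k \<noteq> 0"
  using fls_nth_euler_fls_0[of k] by (metis fls_zero_nth zero_neq_one)

lemma dA_nth_0 [simp]: "dA $$ 0 = 1"
  by (simp add: dA_def fps_class_def)

lemma dA_nonzero [simp]: "dA \<noteq> 0"
  using dA_nth_0 by (metis fls_zero_nth zero_neq_one)

lemma dC_nonzero [simp]: "dC \<noteq> 0"
  by (simp add: dC_def)

lemma euler_fls_1: "euler_fls 1 = dA - dC + dB"
proof -
  have "euler_fls 1 = fps_to_fls euler" by (simp add: euler_fls_def)
  also have "\<dots> = dA - dC + dB"
    by (subst euler_dissection)
       (simp add: dA_def dB_def dC_def euler_fls_def fls_times_fps_to_fls)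
  finally show ?thesis .
qed

abbreviation V2 :: "complex fls \<Rightarrow> complex fls" where "V2 f \<equiv> fls_compose_power f 2"

lemma V2_nonzero [simp]: "f \<noteq> 0 \<Longrightarrow> V2 f \<noteq> 0"
proof -
  assume "f \<noteq> 0"
  then obtain n where "f $$ n \<noteq> 0" by (auto simp: fls_eq_iff)
  hence "V2 f $$ (2 * n) \<noteq> 0" by (simp add: fls_nth_compose_power)
  thus ?thesis by auto
qed

lemma graded_dissection: "graded 0 dA" "graded 1 dC" "graded 2 dB"
proof -
  show "graded 0 dA" "graded 2 dB" 
    using graded_fps_class[of 0 euler] graded_fps_class[of 2 euler] by (simp_all add: dA_def dB_def)
  have "euler_fls 25 = fls_compose_power (euler_fls 5) 5" by (simp add: euler_fls_compose)
  hence "graded 0 (euler_fls 25)" by (simp only: graded_compose_power)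
  moreover have "graded 1 (fls_X :: complex fls)" by (auto simp: graded_def)
  ultimately show "graded 1 dC" unfolding dC_def by (intro graded_mult'[of 1 fls_X 0]) simp_all
qed

text \<open>Here u C, -C, -C/u are the parts of f_1, and v D, -D, -D/v those of f_2; p0, p1, p4 are
  the parts of \<open>phi\<close>. The hypotheses \<open>e0\<close>, \<open>e4\<close>,
  \<open>e1\<close> are the classes 0, 4, 1 of f_1^2 = phi f_2. Eliminating p1 and p4 gives the
  claim times the spurious factor u v^2 - 1, which \<open>ne\<close> removes.\<close>

lemma field_rr_relation:
  fixes u v :: "'a::field"
  assumes nz: "u \<noteq> 0" "v \<noteq> 0" "C \<noteq> 0" "D \<noteq> 0"
  assumes p0: "p0 * D = C\<^sup>2"
  assumes e0: "(u * C)\<^sup>2 = p0 * (v * D) + p1 * (- D / v)"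
  assumes e4: "(- C / u)\<^sup>2 = p4 * (v * D) + p0 * (- D / v)"
  assumes e1: "- 2 * (u * C) * C = p1 * (v * D) - p4 * D"
  assumes ne: "u * v\<^sup>2 \<noteq> 1"
  shows "u\<^sup>2 * (u * v\<^sup>2 - 1) = v * (u * v\<^sup>2 + 1)"
proof -
  have "p1 * D = v * (p0 * D) * v - u\<^sup>2 * v * C\<^sup>2"
    using e0 nz by (simp add: field_simps power2_eq_square)
  hence p1: "p1 * D = C\<^sup>2 * (v\<^sup>2 - u\<^sup>2 * v)" unfolding p0 by (simp add: algebra_simps power2_eq_square)
  have "p4 * D * u\<^sup>2 * v\<^sup>2 = C\<^sup>2 * v + (p0 * D) * u\<^sup>2"
    using e4 nz by (simp add: field_simps power2_eq_square)
  hence p4: "p4 * D * u\<^sup>2 * v\<^sup>2 = C\<^sup>2 * (v + u\<^sup>2)" unfolding p0 by (simp add: algebra_simps)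
  have "(- 2 * (u * C) * C) * (u\<^sup>2 * v\<^sup>2) = (p1 * D) * v * (u\<^sup>2 * v\<^sup>2) - p4 * D * u\<^sup>2 * v\<^sup>2"
    unfolding e1 by (simp add: algebra_simps)
  hence "C\<^sup>2 * (- 2 * u ^ 3 * v\<^sup>2) = C\<^sup>2 * ((v\<^sup>2 - u\<^sup>2 * v) * v * (u\<^sup>2 * v\<^sup>2) - (v + u\<^sup>2))"
    unfolding p1 p4 by (simp add: algebra_simps power2_eq_square power3_eq_cube)
  hence "- 2 * u ^ 3 * v\<^sup>2 = (v\<^sup>2 - u\<^sup>2 * v) * v * (u\<^sup>2 * v\<^sup>2) - (v + u\<^sup>2)"
    by (rule mult_left_cancel[THEN iffD1, rotated]) (use nz in simp)
  hence "(u * v\<^sup>2 - 1) * (u\<^sup>2 * (u * v\<^sup>2 - 1) - v * (u * v\<^sup>2 + 1)) = 0"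
    by (simp add: algebra_simps power2_eq_square power3_eq_cube)
  thus ?thesis using ne by simp
qed

text \<open>
  With R the Rogers--Ramanujan continued fraction, including its factor q^(1/5), these are
  rru = 1/R(q^5), rrv = 1/R(q^10), and rra is the reciprocal of Ramanujan's parameter
  k = R(q) R(q^2)^2 at q^5.
\<close>

definition rru :: "complex fls" where "rru = dA / dC"
definition rrv :: "complex fls" where "rrv = V2 dA / V2 dC"
definition rra :: "complex fls" where "rra = rru * rrv\<^sup>2"

lemma rr_nonzero [simp]: "rru \<noteq> 0" "rrv \<noteq> 0" "rra \<noteq> 0"
  by (simp_all add: rru_def rrv_def rra_def)

text \<open>Together with \<open>rra_den\<close> this writes \<open>rra\<close> as N / (q^5 D) with
  power series N, D of constant term 1, so that later questions are decided by constant
  terms.\<close>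

definition rra_num :: "complex fps" where
  "rra_num = fps_class 0 euler * (fps_class 0 euler oo fps_X ^ 2) ^ 2"
definition rra_den :: "complex fps" where
  "rra_den = (euler oo fps_X ^ 25) * (euler oo fps_X ^ 50) ^ 2"

lemma rra_num_den_nth_0 [simp]: "rra_num $ 0 = 1" "rra_den $ 0 = 1"
  by (simp_all add: rra_num_def rra_den_def fps_class_def power2_eq_square)

lemma V2_dC: "V2 dC = fls_X ^ 2 * euler_fls 50"
proof -
  have "V2 fls_X = fls_X ^ 2" by (simp flip: fls_X_power_int)
  thus ?thesis by (simp add: dC_def euler_fls_compose)
qed

lemma rra_eq: "rra = fps_to_fls rra_num / (fls_X ^ 5 * fps_to_fls rra_den)"
proof -
  have 1: "dA * (V2 dA) ^ 2 = fps_to_fls rra_num"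
    by (simp add: rra_num_def dA_def fls_compose_power_fps_to_fls fls_times_fps_to_fls fps_to_fls_power)
  have 2: "dC * (V2 dC) ^ 2 = fls_X ^ 5 * fps_to_fls rra_den"
    unfolding V2_dC by (simp add: rra_den_def dC_def euler_fls_def fls_times_fps_to_fls fps_to_fls_power
        power_mult_distrib eval_nat_numeral mult_ac)
  have "rra = (dA * (V2 dA) ^ 2) / (dC * (V2 dC) ^ 2)"
    by (simp add: rra_def rru_def rrv_def power_divide)
  thus ?thesis unfolding 1 2 .
qed

text \<open>\<open>rra\<close> has a pole at q = 0, so it is not constant. The values 1 and -1
  matter because a - 1 and a + 1 become denominators.\<close>

lemma rra_neq: "rra \<noteq> 1" "rra \<noteq> -1"
proof -
  have "c * (fls_X ^ 5 * fps_to_fls rra_den) \<noteq> fps_to_fls rra_num" if "c = 1 \<or> c = -1" for c :: "complex fls"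
  proof -
    have "(fls_X ^ 5 * fps_to_fls rra_den) $$ 0 = 0"
      by (simp add: fls_X_power_times_conv_shift)
    hence "(c * (fls_X ^ 5 * fps_to_fls rra_den)) $$ 0 = 0" using that by auto
    moreover have "fps_to_fls rra_num $$ 0 = 1" by simp
    ultimately show ?thesis by (metis zero_neq_one)
  qed
  moreover have "rra * (fls_X ^ 5 * fps_to_fls rra_den) = fps_to_fls rra_num"
  proof -
    have "rra_den \<noteq> 0" using rra_num_den_nth_0(2) by (metis fps_zero_nth zero_neq_one)
    thus ?thesis unfolding rra_eq by simp
  qed
  ultimately show "rra \<noteq> 1" "rra \<noteq> -1" by metis+
qed

text \<open>In class 2 of f_1^2 = phi f_2 the right side has only the term -p0 * V2 dC, and p0 * V2
  dC = dC^2. Hence dC^2 + 2 dA dB = -dC^2, which is the reciprocity of the outer terms without any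
  product formula for them. The classes 0, 1 and 4 feed \<open>field_rr_relation\<close>.\<close>

lemma rr_relations:
  "dA * dB = - dC\<^sup>2"
  "rru\<^sup>2 * (rra - 1) = rrv * (rra + 1)"
proof -
  define p0 where "p0 = fps_to_fls (phi oo fps_X ^ 25 :: complex fps)"
  define p1 where "p1 = fps_to_fls (fps_class 1 phi :: complex fps)"
  define p4 where "p4 = fps_to_fls (fps_class 4 phi :: complex fps)"
  have p0': "p0 = fls_compose_power (fls_compose_power (fps_to_fls phi) 5) 5"
    unfolding p0_def fls_compose_power_fps_to_fls[OF zero_less_numeral]
    by (intro arg_cong[where f = fps_to_fls] fps_ext)
       (auto simp: fps_nth_compose_X_power dvd_div_iff_mult div_mult2_eq[symmetric])
  have phi: "fps_to_fls phi = p0 + p1 + p4"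
    unfolding p0_def p1_def p4_def by (subst phi_dissection) simp
  have g: "graded 0 p0" "graded 1 p1" "graded 4 p4"
    using graded_fps_class[of 1 phi] graded_fps_class[of 4 phi]
    by (auto simp: p0' p1_def p4_def)
  note dg = graded_dissection
  have dg2: "graded 0 (V2 dA)" "graded 2 (V2 dC)" "graded 4 (V2 dB)"
    using dg[THEN graded_compose_power_2] by auto
  have e2: "euler_fls 2 = V2 dA - V2 dC + V2 dB"
    using arg_cong[OF euler_fls_1, of V2] by (simp add: euler_fls_compose)
  have "euler_fls 1 ^ 2 = fps_to_fls (phi * (euler oo fps_X ^ 2))"
    unfolding euler_squared[symmetric] by (simp add: euler_fls_def fps_to_fls_power)
  also have "\<dots> = fps_to_fls phi * euler_fls 2"
    by (simp add: euler_fls_def fls_times_fps_to_fls)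
  finally have sq: "(dA - dC + dB)\<^sup>2 = (p0 + p1 + p4) * (V2 dA - V2 dC + V2 dB)"
    unfolding euler_fls_1 e2 phi .
  hence eq: "dA\<^sup>2 + (- 2 * dA * dC) + (dC\<^sup>2 + 2 * dA * dB) + (- 2 * dB * dC) + dB\<^sup>2
     = (p0 * V2 dA + p1 * V2 dB) + (p1 * V2 dA - p4 * V2 dC) + (- (p0 * V2 dC))
       + (p4 * V2 dB - p1 * V2 dC) + (p4 * V2 dA + p0 * V2 dB)"
    by (simp add: algebra_simps power2_eq_square)
  have gm: "graded 0 (dA\<^sup>2)"
    "graded 1 (dA * dC)"
    "graded 2 (dC\<^sup>2)"
    "graded 2 (dA * dB)"
    "graded 3 (dB * dC)"
    "graded 4 (dB\<^sup>2)"
    "graded 0 (p0 * V2 dA)"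
    "graded 0 (p1 * V2 dB)"
    "graded 1 (p1 * V2 dA)"
    "graded 1 (p4 * V2 dC)"
    "graded 2 (p0 * V2 dC)"
    "graded 3 (p4 * V2 dB)"
    "graded 3 (p1 * V2 dC)"
    "graded 4 (p4 * V2 dA)"
    "graded 4 (p0 * V2 dB)"
    unfolding power2_eq_square
    apply (rule graded_mult'[OF dg(1) dg(1)], simp)
    apply (rule graded_mult'[OF dg(1) dg(2)], simp)
    apply (rule graded_mult'[OF dg(2) dg(2)], simp)
    apply (rule graded_mult'[OF dg(1) dg(3)], simp)
    apply (rule graded_mult'[OF dg(3) dg(2)], simp)
    apply (rule graded_mult'[OF dg(3) dg(3)], simp)
    apply (rule graded_mult'[OF g(1) dg2(1)], simp)
    apply (rule graded_mult'[OF g(2) dg2(3)], simp)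
    apply (rule graded_mult'[OF g(2) dg2(1)], simp)
    apply (rule graded_mult'[OF g(3) dg2(2)], simp)
    apply (rule graded_mult'[OF g(1) dg2(2)], simp)
    apply (rule graded_mult'[OF g(3) dg2(3)], simp)
    apply (rule graded_mult'[OF g(2) dg2(2)], simp)
    apply (rule graded_mult'[OF g(3) dg2(1)], simp)
    apply (rule graded_mult'[OF g(1) dg2(3)], simp)
    done
  have gm2: "graded 1 (- 2 * dA * dC)" "graded 3 (- 2 * dB * dC)" "graded 2 (2 * dA * dB)"
    using graded_uminus[OF graded_numeral_mult[OF gm(2)]] graded_uminus[OF graded_numeral_mult[OF gm(5)]]
      graded_numeral_mult[OF gm(4)] by (simp_all add: mult.assoc)
  note gl = gm(1) gm2(1) graded_add[OF gm(3) gm2(3)] gm2(2) gm(6)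
    graded_add[OF gm(7,8)] graded_diff[OF gm(9,10)] graded_uminus[OF gm(11)] graded_diff[OF gm(12,13)] graded_add[OF gm(14,15)]
  have "dA\<^sup>2 = p0 * V2 dA + p1 * V2 dB \<and> - 2 * dA * dC = p1 * V2 dA - p4 * V2 dC \<and>
      dC\<^sup>2 + 2 * dA * dB = - (p0 * V2 dC) \<and> dB\<^sup>2 = p4 * V2 dA + p0 * V2 dB"
    by (intro conjI graded_unique5[OF gl eq])
  hence r0: "dA\<^sup>2 = p0 * V2 dA + p1 * V2 dB" and r1: "- 2 * dA * dC = p1 * V2 dA - p4 * V2 dC"
    and r2: "dC\<^sup>2 + 2 * dA * dB = - (p0 * V2 dC)" and r4: "dB\<^sup>2 = p4 * V2 dA + p0 * V2 dB" by blast+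
  \<comment> \<open>This is f_1^2 = phi f_2 at q^25; the factor q^2 is present on both
    sides.\<close>
  have "dC\<^sup>2 = p0 * V2 dC"
  proof -
    have "(euler oo fps_X ^ 25)\<^sup>2 = ((euler\<^sup>2) oo fps_X ^ 25 :: complex fps)"
      by (simp add: fps_compose_power)
    also have "\<dots> = (phi oo fps_X ^ 25) * ((euler oo fps_X ^ 2) oo fps_X ^ 25)"
      unfolding euler_squared by (simp add: fps_compose_mult_distrib)
    also have "(euler oo fps_X ^ 2) oo fps_X ^ 25 = (euler oo fps_X ^ 50 :: complex fps)"
      by (intro fps_ext) (auto simp: fps_nth_compose_X_power dvd_div_iff_mult div_mult2_eq[symmetric])
    finally have "euler_fls 25 ^ 2 = p0 * euler_fls 50"
      by (simp add: euler_fls_def p0_def flip: fps_to_fls_power fls_times_fps_to_fls)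
    moreover have "dC\<^sup>2 = fls_X ^ 2 * euler_fls 25 ^ 2" by (simp add: dC_def power_mult_distrib)
    ultimately show ?thesis unfolding V2_dC by simp
  qed
  hence p0: "p0 * V2 dC = dC\<^sup>2" by simp
  have "2 * (dA * dB) = 2 * (- dC\<^sup>2)" using r2 unfolding p0 by (simp add: algebra_simps eq_neg_iff_add_eq_0)
  thus AB: "dA * dB = - dC\<^sup>2" by simp
  have "V2 (dA * dB) = V2 (- dC\<^sup>2)" unfolding AB ..
  hence AB2: "V2 dA * V2 dB = - (V2 dC)\<^sup>2" by simp
  have A: "dA = rru * dC" "V2 dA = rrv * V2 dC" by (simp_all add: rru_def rrv_def)
  have B: "dB = - dC / rru" using AB unfolding rru_def by (simp add: field_simps power2_eq_square)
  have B2: "V2 dB = - V2 dC / rrv" using AB2 unfolding rrv_def by (simp add: field_simps power2_eq_square)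
  show "rru\<^sup>2 * (rra - 1) = rrv * (rra + 1)"
    unfolding rra_def
  proof (rule field_rr_relation[where C = dC and D = "V2 dC" and ?p0.0 = p0 and ?p1.0 = p1 and ?p4.0 = p4])
    show "(rru * dC)\<^sup>2 = p0 * (rrv * V2 dC) + p1 * (- V2 dC / rrv)"
      using r0 unfolding A(2) B2 unfolding A(1) B .
    show "(- dC / rru)\<^sup>2 = p4 * (rrv * V2 dC) + p0 * (- V2 dC / rrv)"
      using r4 unfolding A(2) B2 unfolding A(1) B .
    show "- 2 * (rru * dC) * dC = p1 * (rrv * V2 dC) - p4 * V2 dC"
      using r1 unfolding A(2) B2 unfolding A(1) B .
    show "rru * rrv\<^sup>2 \<noteq> 1" using rra_neq(1) by (simp add: rra_def)
  qed (use p0 in simp_all)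
qed

lemma fls_compose_power_1_divide:
  fixes f :: "'a::field fls"
  assumes "d > 0" shows "fls_compose_power (1 / f) d = 1 / fls_compose_power f d"
proof (cases "f = 0")
  case False
  hence "fls_compose_power (1 / f * f) d = 1" using assms by simp
  thus ?thesis using False unfolding fls_compose_power_mult by (metis nonzero_eq_divide_eq mult_zero_right zero_neq_one)
qed simp

lemma V2_rru: "V2 rru = rrv"
proof -
  have "dA = rru * dC" by (simp add: rru_def)
  hence "V2 dA = V2 (rru * dC)" by (rule arg_cong)
  thus ?thesis by (simp add: rrv_def)
qed

lemma euler_fls_1_rr: "euler_fls 1 = dC * (rru - 1 - 1 / rru)"
  and euler_fls_2_rr: "euler_fls 2 = V2 dC * (rrv - 1 - 1 / rrv)"
proof -
  have B: "dB = - dC / rru" using rr_relations(1) unfolding rru_def by (simp add: field_simps power2_eq_square)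
  have "euler_fls 1 = rru * dC - dC + dB" unfolding euler_fls_1 by (simp add: rru_def)
  thus 1: "euler_fls 1 = dC * (rru - 1 - 1 / rru)" by (simp add: B algebra_simps)
  show "euler_fls 2 = V2 dC * (rrv - 1 - 1 / rrv)"
    using arg_cong[OF 1, of V2] by (simp add: euler_fls_compose V2_rru fls_compose_power_1_divide)
qed

subsection \<open>Norms over the fifth roots of unity\<close>

definition zeta5 :: complex where "zeta5 = cis (2 * pi / 5)"

lemma zeta5_power: "zeta5 ^ 5 = 1"
  by (simp add: zeta5_def DeMoivre)

lemma zeta5_neq_1: "zeta5 \<noteq> 1"
proof
  assume "zeta5 = 1"
  hence "sin (2 * pi / 5) = 0" by (simp add: zeta5_def complex_eq_iff)
  moreover have "sin (2 * pi / 5) > 0" by (intro sin_gt_zero) auto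
  ultimately show False by simp
qed

text \<open>Substitution of zeta^j q for q. The fifth roots of unity are the reason for working with
  complex coefficients.\<close>

definition rot :: "nat \<Rightarrow> complex fps \<Rightarrow> complex fps" where
  "rot j f = f oo (fps_const (zeta5 ^ j) * fps_X)"

lemma rot_nth: "rot j f $ n = zeta5 ^ (j * n) * f $ n"
  by (simp add: rot_def fps_compose_linear power_mult)

lemma rot_add: "rot j (f + g) = rot j f + rot j g"
  and rot_diff: "rot j (f - g) = rot j f - rot j g"
  by (simp_all add: rot_def fps_compose_add_distrib fps_compose_sub_distrib)

lemma rot_1 [simp]: "rot j 1 = 1"
  by (simp add: rot_def)

lemma rot_prod: "rot j (\<Prod>k\<in>A. f k) = (\<Prod>k\<in>A. rot j (f k))"
  unfolding rot_def by (rule fps_compose_prod_distrib) simp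

lemma rot_X_power: "rot j (fps_X ^ k) = fps_const (zeta5 ^ (j * k)) * fps_X ^ k"
  by (rule fps_ext) (simp add: rot_nth fps_X_power_nth)

lemma zeta5_power_mod: "zeta5 ^ n = zeta5 ^ (n mod 5)"
proof -
  have "zeta5 ^ n = zeta5 ^ (5 * (n div 5) + n mod 5)" by simp
  also have "\<dots> = zeta5 ^ (n mod 5)" unfolding power_add power_mult by (simp add: zeta5_power)
  finally show ?thesis .
qed

lemma zeta5_cyclotomic:
  assumes "\<not> 5 dvd k"
  shows "1 + zeta5 ^ k + zeta5 ^ (2 * k) + zeta5 ^ (3 * k) + zeta5 ^ (4 * k) = 0"
proof -
  have c: "1 + zeta5 + zeta5 ^ 2 + zeta5 ^ 3 + zeta5 ^ 4 = 0"
  proof -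
    have "(zeta5 - 1) * (1 + zeta5 + zeta5 ^ 2 + zeta5 ^ 3 + zeta5 ^ 4) = zeta5 ^ 5 - 1"
      by (simp add: algebra_simps eval_nat_numeral)
    thus ?thesis using zeta5_power zeta5_neq_1 by simp
  qed
  have m: "zeta5 ^ (a * k) = zeta5 ^ (a * (k mod 5) mod 5)" for a
    by (subst zeta5_power_mod) (simp add: mod_mult_right_eq)
  have "k mod 5 \<noteq> 0" "k mod 5 < 5" using assms by (auto simp: dvd_eq_mod_eq_0)
  hence "k mod 5 = 1 \<or> k mod 5 = 2 \<or> k mod 5 = 3 \<or> k mod 5 = 4" by linarith
  hence "1 + zeta5 ^ (1 * k) + zeta5 ^ (2 * k) + zeta5 ^ (3 * k) + zeta5 ^ (4 * k) = 0"
    unfolding m using c by (elim disjE) (simp_all add: add_ac power2_eq_square)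
  thus ?thesis by simp
qed

lemma prod_5: "(\<Prod>j<5. f j) = f 0 * f 1 * f 2 * f 3 * f (4::nat)" for f :: "nat \<Rightarrow> 'a::comm_monoid_mult"
  by (simp add: eval_nat_numeral mult_ac)

lemma prod_1_minus_root:
  fixes w y :: "'a::comm_ring_1"
  assumes "1 + w + w ^ 2 + w ^ 3 + w ^ 4 = 0"
  shows "(1 - y) * (1 - w * y) * (1 - w ^ 2 * y) * (1 - w ^ 3 * y) * (1 - w ^ 4 * y) = 1 - y ^ 5"
proof -
  have w4: "w ^ 4 = - 1 - w - w ^ 2 - w ^ 3" using assms by (simp add: algebra_simps eq_neg_iff_add_eq_0)
  have "w ^ 5 - 1 = (w - 1) * (1 + w + w ^ 2 + w ^ 3 + w ^ 4)" by (simp add: algebra_simps eval_nat_numeral)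
  hence w5: "w ^ 5 = 1" unfolding assms by simp
  \<comment> \<open>\<open>p\<close> and \<open>r\<close> are the Gaussian periods, with p + r = p r
    = -1. Pairing the factors for w^i and w^(5-i) leaves expressions in the periods only.\<close>
  define p where "p = w + w ^ 4"
  define r where "r = w ^ 2 + w ^ 3"
  have pr: "p + r = - 1" using w4 by (simp add: p_def r_def)
  have "p * r = w ^ 3 + w ^ 4 + w ^ 5 * w + w ^ 5 * w ^ 2" 
    unfolding p_def r_def by (simp add: algebra_simps eval_nat_numeral)
  also have "\<dots> = - 1" unfolding w5 w4 by (simp add: algebra_simps)
  finally have pr': "p * r = - 1" .
  have "(1 - w * y) * (1 - w ^ 4 * y) = 1 - p * y + w ^ 5 * y ^ 2"
    unfolding p_def by (simp add: algebra_simps eval_nat_numeral)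
  hence 1: "(1 - w * y) * (1 - w ^ 4 * y) = 1 - p * y + y ^ 2" unfolding w5 by simp
  have "(1 - w ^ 2 * y) * (1 - w ^ 3 * y) = 1 - r * y + w ^ 5 * y ^ 2"
    unfolding r_def by (simp add: algebra_simps eval_nat_numeral)
  hence 2: "(1 - w ^ 2 * y) * (1 - w ^ 3 * y) = 1 - r * y + y ^ 2" unfolding w5 by simp
  have "(1 - y) * (1 - w * y) * (1 - w ^ 2 * y) * (1 - w ^ 3 * y) * (1 - w ^ 4 * y)
     = (1 - y) * (((1 - w * y) * (1 - w ^ 4 * y)) * ((1 - w ^ 2 * y) * (1 - w ^ 3 * y)))"
    by (simp only: mult_ac)
  also have "\<dots> = (1 - y) * (1 - (p + r) * y + (2 + p * r) * y ^ 2 - (p + r) * y ^ 3 + y ^ 4)"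
    unfolding 1 2 by (simp add: algebra_simps eval_nat_numeral)
  also have "\<dots> = 1 - y ^ 5" unfolding pr pr' by (simp add: algebra_simps eval_nat_numeral)
  finally show ?thesis .
qed

text \<open>A norm form, evaluated by pairing conjugate factors and reducing with p^2 = 1 - p.
  Stating the hypothesis as the cyclotomic equation allows w to be a constant power series.\<close>

lemma prod_trinomial_root:
  fixes w x y z :: "'a::comm_ring_1"
  assumes "1 + w + w ^ 2 + w ^ 3 + w ^ 4 = 0"
  shows "(x + y + z) * (x + w * y + w ^ 2 * z) * (x + w ^ 2 * y + w ^ 4 * z)
           * (x + w ^ 3 * y + w * z) * (x + w ^ 4 * y + w ^ 3 * z)
         = x ^ 5 + y ^ 5 + z ^ 5 - 5 * x * y ^ 3 * z + 5 * x ^ 2 * y * z ^ 2"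
proof -
  have w4: "w ^ 4 = - 1 - w - w ^ 2 - w ^ 3" using assms by (simp add: algebra_simps eq_neg_iff_add_eq_0)
  have "w ^ 5 - 1 = (w - 1) * (1 + w + w ^ 2 + w ^ 3 + w ^ 4)" by (simp add: algebra_simps eval_nat_numeral)
  hence w5: "w ^ 5 = 1" unfolding assms by simp
  define p where "p = w + w ^ 4"
  define r where "r = w ^ 2 + w ^ 3"
  have r: "r = - 1 - p" using w4 by (simp add: p_def r_def)
  have "p * r = w ^ 3 + w ^ 4 + w ^ 5 * w + w ^ 5 * w ^ 2" 
    unfolding p_def r_def by (simp add: algebra_simps eval_nat_numeral)
  also have "\<dots> = - 1" unfolding w5 w4 by (simp add: algebra_simps)
  finally have "p * r = - 1" .
  hence pp: "p * p = 1 - p" unfolding r by (simp add: algebra_simps)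
  hence pp': "p * (p * x) = x - p * x" for x by (metis mult.assoc left_diff_distrib mult_1)
  have "(x + w * y + w ^ 2 * z) * (x + w ^ 4 * y + w ^ 3 * z)
       = x\<^sup>2 + w ^ 5 * y\<^sup>2 + w ^ 5 * z\<^sup>2 + p * (x * y) + r * (x * z) + (w ^ 4 + w ^ 5 * w) * (y * z)"
    unfolding p_def r_def by (simp add: algebra_simps eval_nat_numeral)
  hence 1: "(x + w * y + w ^ 2 * z) * (x + w ^ 4 * y + w ^ 3 * z) = x\<^sup>2 + y\<^sup>2 + z\<^sup>2 + p * (x * y + y * z) + r * (x * z)"
    unfolding w5 p_def by (simp add: algebra_simps)
  have "(x + w ^ 2 * y + w ^ 4 * z) * (x + w ^ 3 * y + w * z)
       = x\<^sup>2 + w ^ 5 * y\<^sup>2 + w ^ 5 * z\<^sup>2 + r * (x * y) + p * (x * z) + (w ^ 3 + w ^ 5 * w ^ 2) * (y * z)"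
    unfolding p_def r_def by (simp add: algebra_simps eval_nat_numeral)
  hence 2: "(x + w ^ 2 * y + w ^ 4 * z) * (x + w ^ 3 * y + w * z) = x\<^sup>2 + y\<^sup>2 + z\<^sup>2 + r * (x * y + y * z) + p * (x * z)"
    unfolding w5 r_def by (simp add: algebra_simps)
  have "(x + y + z) * (x + w * y + w ^ 2 * z) * (x + w ^ 2 * y + w ^ 4 * z)
           * (x + w ^ 3 * y + w * z) * (x + w ^ 4 * y + w ^ 3 * z)
     = (x + y + z) * (((x + w * y + w ^ 2 * z) * (x + w ^ 4 * y + w ^ 3 * z)) * ((x + w ^ 2 * y + w ^ 4 * z) * (x + w ^ 3 * y + w * z)))"
    by (simp only: mult_ac)
  also have "\<dots> = x ^ 5 + y ^ 5 + z ^ 5 - 5 * x * y ^ 3 * z + 5 * x ^ 2 * y * z ^ 2"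
    unfolding 1 2 r by (simp add: algebra_simps eval_nat_numeral pp pp')
  finally show ?thesis .
qed

lemma rot_norm_factor:
  "(\<Prod>j<5. rot j (1 - fps_X ^ k)) = (if 5 dvd k then (1 - fps_X ^ k) ^ 5 else 1 - fps_X ^ (5 * k))"
proof (cases "5 dvd k")
  case True
  have "zeta5 ^ (j * k) = 1" for j 
    using True by (subst zeta5_power_mod) (simp add: mod_eq_0_iff_dvd[THEN iffD2])
  hence "rot j (1 - fps_X ^ k) = 1 - fps_X ^ k" for j
    by (simp add: rot_diff rot_X_power)
  thus ?thesis using True by simp
next
  case False
  define w where "w = fps_const (zeta5 ^ k)"
  have w: "fps_const (zeta5 ^ (j * k)) = w ^ j" for j
    by (simp add: w_def fps_const_power flip: power_mult) (simp add: mult.commute)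
  have c: "1 + w + w ^ 2 + w ^ 3 + w ^ 4 = 0"
    using zeta5_cyclotomic[OF False] arg_cong[where f = fps_const] unfolding w[symmetric]
    by (simp add: w_def flip: fps_const_1_eq_1 fps_const_add)
  show ?thesis
    unfolding prod_5 rot_diff rot_1 rot_X_power w
    using False prod_1_minus_root[OF c, of "fps_X ^ k"] 
    by (simp flip: power_mult add: mult.commute)
qed

lemma euler_trunc_compose:
  "d > 0 \<Longrightarrow> (euler_trunc n oo fps_X ^ d :: complex fps) = (\<Prod>k\<in>{1..n}. 1 - fps_X ^ (d * k))"
  unfolding euler_trunc_def
  by (subst fps_compose_prod_distrib) (simp_all add: fps_compose_sub_distrib fps_X_power_compose power_mult)

text \<open>Truncation of N(f_1) f_25 = f_5^6. The factors with 5 not dividing k have norms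
  multiplying to f_5 / f_25, the others to f_5^5. The bound 5n on one side matches n on the other,
  since the multiples of 5 up to 5n are 5k with k \<le> n.\<close>

lemma euler_trunc_norm:
  "(\<Prod>j<5. rot j (euler_trunc (5 * n))) * (euler_trunc n oo fps_X ^ 25)
    = (euler_trunc (5 * n) oo fps_X ^ 5) * (euler_trunc n oo fps_X ^ 5) ^ 5"
proof -
  define h :: "nat \<Rightarrow> complex fps" where "h = (\<lambda>k. \<Prod>j<5. rot j (1 - fps_X ^ k))"
  have h: "h k = (if 5 dvd k then (1 - fps_X ^ k) ^ 5 else 1 - fps_X ^ (5 * k))" for k
    unfolding h_def by (rule rot_norm_factor)
  have "(\<Prod>j<5. rot j (euler_trunc (5 * n))) = (\<Prod>k\<in>{1..5*n}. h k)"
    unfolding euler_trunc_def rot_prod h_def by (rule prod.swap)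
  moreover have "(\<Prod>k\<in>{1..5*n}. h k) * (\<Prod>k\<in>{1..n}. 1 - fps_X ^ (25 * k))
      = (\<Prod>k\<in>{1..5*n}. 1 - fps_X ^ (5 * k)) * (\<Prod>k\<in>{1..n}. 1 - fps_X ^ (5 * k)) ^ 5"
  proof (induction n)
    case (Suc n)
    have e: "(\<Prod>k\<in>{1..5*Suc n}. g k) = (\<Prod>k\<in>{1..5*n}. g k) * g (5*n+1) * g (5*n+2) * g (5*n+3) * g (5*n+4) * g (5 * Suc n)"
      for g :: "nat \<Rightarrow> complex fps"
      by (simp add: eval_nat_numeral mult_ac)
    have n: "\<not> 5 dvd 5*n+1" "\<not> 5 dvd 5*n+2" "\<not> 5 dvd 5*n+3" "\<not> 5 dvd 5*n+4" by presburger+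
    have hs: "h (5*n+1) = 1 - fps_X ^ (5*(5*n+1))" "h (5*n+2) = 1 - fps_X ^ (5*(5*n+2))"
      "h (5*n+3) = 1 - fps_X ^ (5*(5*n+3))" "h (5*n+4) = 1 - fps_X ^ (5*(5*n+4))"
      "h (5 * Suc n) = (1 - fps_X ^ (5 * Suc n)) ^ 5"
      unfolding h using n by (simp_all only: if_False if_True dvd_triv_left)
    have "25 * Suc n = 5 * (5 * Suc n)" by simp
    hence p: "(\<Prod>k\<in>{1..Suc n}. 1 - fps_X ^ (25 * k)) = (\<Prod>k\<in>{1..n}. 1 - fps_X ^ (25 * k)) * (1 - fps_X ^ (5 * (5 * Suc n)) :: complex fps)"
      by (simp only: prod.nat_ivl_Suc' le_add2 Suc_eq_plus1[symmetric] mult.commute)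
    have q: "(\<Prod>k\<in>{1..Suc n}. 1 - fps_X ^ (5 * k)) = (\<Prod>k\<in>{1..n}. 1 - fps_X ^ (5 * k)) * (1 - fps_X ^ (5 * Suc n) :: complex fps)"
      by simp
    have alg: "(H * a * b * c * d * x ^ 5) * (K * y) = (M * a * b * c * d * y) * (R * x) ^ 5"
      if "H * K = M * R ^ 5" for H K M R a b c d x y :: "complex fps"
    proof -
      have "(H * a * b * c * d * x ^ 5) * (K * y) = (H * K) * (a * b * c * d * x ^ 5 * y)" by (simp only: mult_ac)
      thus ?thesis unfolding that by (simp only: power_mult_distrib mult_ac)
    qed
    show ?case unfolding e hs p q by (rule alg[OF Suc.IH])
  qed simp
  ultimately show ?thesis by (simp add: euler_trunc_compose)
qed

lemma eqmod_rot: "eqmod n f g \<Longrightarrow> eqmod n (rot j f) (rot j g)"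
  by (simp add: eqmod_def rot_nth)

lemma euler_norm:
  "(\<Prod>j<5. rot j euler) * (euler oo fps_X ^ 25) = (euler oo fps_X ^ 5) ^ 6"
proof (rule eqmod_imp_eq)
  fix n :: nat
  have e: "eqmod n euler (euler_trunc n)" "eqmod n euler (euler_trunc (5 * n))"
    by (rule eqmod_euler; simp)+
  have "eqmod n ((\<Prod>j<5. rot j euler) * (euler oo fps_X ^ 25))
     ((\<Prod>j<5. rot j (euler_trunc (5 * n))) * (euler_trunc n oo fps_X ^ 25))"
    unfolding prod_5 by (intro eqmod_mult eqmod_rot eqmod_compose_X_power e) simp
  moreover have "eqmod n ((euler oo fps_X ^ 5) * (euler oo fps_X ^ 5) ^ 5)
      ((euler_trunc (5 * n) oo fps_X ^ 5) * (euler_trunc n oo fps_X ^ 5) ^ 5 :: complex fps)"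
    by (intro eqmod_mult eqmod_power eqmod_compose_X_power e) simp_all
  ultimately have "eqmod n ((\<Prod>j<5. rot j euler) * (euler oo fps_X ^ 25)) ((euler oo fps_X ^ 5) * (euler oo fps_X ^ 5) ^ 5)"
    unfolding euler_trunc_norm by (rule eqmod_trans[OF _ eqmod_sym])
  thus "eqmod n ((\<Prod>j<5. rot j euler) * (euler oo fps_X ^ 25)) ((euler oo fps_X ^ 5) ^ 6 :: complex fps)"
    by (simp add: eval_nat_numeral)
qed

lemma rot_class:
  assumes "\<And>n. f $ n \<noteq> 0 \<Longrightarrow> n mod 5 = i"
  shows "rot j f = fps_const (zeta5 ^ (j * i)) * f"
proof (rule fps_ext)
  fix n
  show "rot j f $ n = (fps_const (zeta5 ^ (j * i)) * f) $ n"
  proof (cases "f $ n = 0")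
    case False
    hence i: "i = n mod 5" using assms by simp
    have "zeta5 ^ (j * n) = zeta5 ^ (j * i)"
      by (subst (1 2) zeta5_power_mod) (simp add: i mod_mult_right_eq)
    thus ?thesis by (simp add: rot_nth)
  qed (simp add: rot_nth)
qed

text \<open>The quintic form of \<open>prod_trinomial_root\<close> collapses under dA dB = -dC^2:
  its three terms -1, -5 and -5 times dC^5 add up to the classical -11.\<close>

lemma norm_rr: "dC ^ 5 * (rru ^ 5 - 11 - 1 / rru ^ 5) * euler_fls 25 = euler_fls 5 ^ 6"
proof -
  define a b c :: "complex fps" where "a = fps_class 0 euler" and "b = fps_class 2 euler"
    and "c = - (fps_X * (euler oo fps_X ^ 25))"
  define w :: "complex fps" where "w = fps_const zeta5"
  have w: "fps_const (zeta5 ^ j) = w ^ j" for j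
    by (simp add: w_def fps_const_power)
  have E: "euler = a + c + b" unfolding a_def b_def c_def using euler_dissection[where ?'a = complex] by simp
  have ra: "rot j a = a" for j
  proof -
    have "rot j a = fps_const (zeta5 ^ (j * 0)) * a"
      by (rule rot_class) (auto simp: a_def fps_class_def split: if_splits)
    thus ?thesis by simp
  qed
  have rb: "rot j b = w ^ (j * 2) * b" for j 
    unfolding w[symmetric] by (rule rot_class) (auto simp: b_def fps_class_def split: if_splits)
  have rc: "rot j c = w ^ j * c" for j
  proof -
    have "n mod 5 = 1" if "c $ n \<noteq> 0" for n
    proof (cases n)
      case (Suc k)
      with that have "25 dvd k" by (auto simp: c_def fps_nth_compose_X_power split: if_splits)
      thus ?thesis using Suc by presburger
    qed (use that in \<open>auto simp: c_def\<close>)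
    from rot_class[of c 1 j, OF this] show ?thesis by (simp add: w)
  qed
  have "fps_const (1 + zeta5 ^ 1 + zeta5 ^ (2 * 1) + zeta5 ^ (3 * 1) + zeta5 ^ (4 * 1)) = 0"
    by (subst zeta5_cyclotomic) simp_all
  hence cyc: "1 + w + w ^ 2 + w ^ 3 + w ^ 4 = 0"
    by (simp add: w[symmetric] w_def flip: fps_const_1_eq_1 fps_const_add)
  have w5: "w ^ 5 = 1" by (simp add: w[symmetric] zeta5_power)
  have w6: "w ^ 6 = w" "w ^ 8 = w ^ 3"
    using w5 power_add[of w 5 1] power_add[of w 5 3] by simp_all
  have "(\<Prod>j<5. rot j euler) = (a + c + b) * (a + w * c + w ^ 2 * b) * (a + w ^ 2 * c + w ^ 4 * b)
     * (a + w ^ 3 * c + w * b) * (a + w ^ 4 * c + w ^ 3 * b)"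
    unfolding prod_5 E rot_add ra rb rc by (simp add: w6)
  also have "\<dots> = a ^ 5 + c ^ 5 + b ^ 5 - 5 * a * c ^ 3 * b + 5 * a ^ 2 * c * b ^ 2"
    by (rule prod_trinomial_root[OF cyc])
  finally have "(a ^ 5 + c ^ 5 + b ^ 5 - 5 * a * c ^ 3 * b + 5 * a ^ 2 * c * b ^ 2) * (euler oo fps_X ^ 25)
    = (euler oo fps_X ^ 5) ^ 6" using euler_norm by simp
  from arg_cong[OF this, of fps_to_fls]
  have *: "(dA ^ 5 + (- dC) ^ 5 + dB ^ 5 - 5 * dA * (- dC) ^ 3 * dB + 5 * dA ^ 2 * (- dC) * dB ^ 2) * euler_fls 25
    = euler_fls 5 ^ 6"
    by (simp add: fls_times_fps_to_fls fps_to_fls_power a_def b_def c_def dA_def dB_def dC_def euler_fls_def)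
  have "dA ^ 5 + (- dC) ^ 5 + dB ^ 5 - 5 * dA * (- dC) ^ 3 * dB + 5 * dA ^ 2 * (- dC) * dB ^ 2
    = dA ^ 5 - dC ^ 5 + dB ^ 5 + 5 * dC ^ 3 * (dA * dB) - 5 * dC * (dA * dB) ^ 2"
    by (simp add: algebra_simps eval_nat_numeral)
  also have "\<dots> = dA ^ 5 - 11 * dC ^ 5 + dB ^ 5" unfolding rr_relations
    by (simp add: algebra_simps eval_nat_numeral)
  also have "\<dots> = dC ^ 5 * (rru ^ 5 - 11 - 1 / rru ^ 5)"
  proof -
    have A: "dA = rru * dC" by (simp add: rru_def)
    have B: "dB = - dC / rru" using rr_relations(1) unfolding rru_def by (simp add: field_simps power2_eq_square)
    show ?thesis unfolding A B by (simp add: field_simps)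
  qed
  finally show ?thesis using * by simp
qed

lemma norm_rr2: "V2 dC ^ 5 * (rrv ^ 5 - 11 - 1 / rrv ^ 5) * euler_fls 50 = euler_fls 10 ^ 6"
proof -
  have 11: "V2 11 = 11" using fls_compose_power_const_left[of 2 "11 :: complex"] by simp
  show ?thesis
    using arg_cong[OF norm_rr, of V2] by (simp add: fls_compose_power_1_divide V2_rru euler_fls_compose 11)
qed

subsection \<open>The modular equation of degree 5\<close>

text \<open>Algebra in an arbitrary field. The two relations make u^5 and v^5 rational in a
  (\<open>u5\<close>, \<open>v5\<close>), so identities of degree divisible by 5 in u become
  identities between rational functions of a.\<close>

locale rr_param =
  fixes u v a :: "'a::field"
  assumes nz: "u \<noteq> 0" "v \<noteq> 0" "a \<noteq> 0" "a \<noteq> 1" "a \<noteq> -1"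
    and a: "a = u * v\<^sup>2"
    and rel: "u\<^sup>2 * (a - 1) = v * (a + 1)"
begin

lemma nz': "a - 1 \<noteq> 0" "a + 1 \<noteq> 0"
  using nz by (auto simp: eq_neg_iff_add_eq_0)

lemma v_eq: "v = u\<^sup>2 * (a - 1) / (a + 1)"
  using rel nz' by (simp add: field_simps)

lemma u5: "u ^ 5 = a * (a + 1)\<^sup>2 / (a - 1)\<^sup>2"
proof -
  have "u ^ 5 * (a - 1)\<^sup>2 = u * (u\<^sup>2 * (a - 1))\<^sup>2" by (simp add: power_mult_distrib eval_nat_numeral)
  also have "\<dots> = (u * v\<^sup>2) * (a + 1)\<^sup>2" unfolding rel by (simp add: power_mult_distrib)
  also have "\<dots> = a * (a + 1)\<^sup>2" unfolding a[symmetric] ..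
  finally show ?thesis using nz' by (simp add: field_simps)
qed

lemma v5: "v ^ 5 = a\<^sup>2 * (a - 1) / (a + 1)"
proof -
  have "v ^ 5 * (a + 1) = v ^ 4 * (v * (a + 1))" by (simp add: eval_nat_numeral)
  also have "\<dots> = a\<^sup>2 * (a - 1)" unfolding rel[symmetric] by (simp add: a power_mult_distrib eval_nat_numeral)
  finally show ?thesis using nz' by (simp add: field_simps)
qed

text \<open>The cube root of the product of the two norms (\<open>norm_uv\<close>); for the actual
  series it is 1/t(q^5), as shown in \<open>rr_S\<close>.\<close>

definition "S = (a\<^sup>2 + a - 1) * (a\<^sup>2 - 4 * a - 1) / (a * (a - 1) * (a + 1))"

lemma norm_u: "u ^ 5 - 11 - 1 / u ^ 5 = (a\<^sup>2 + a - 1) * (a\<^sup>2 - 4 * a - 1)\<^sup>2 / (a * (a - 1)\<^sup>2 * (a + 1)\<^sup>2)"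
  unfolding u5 using nz nz' by (simp add: divide_simps) (simp add: algebra_simps eval_nat_numeral)

lemma norm_v: "v ^ 5 - 11 - 1 / v ^ 5 = (a\<^sup>2 + a - 1)\<^sup>2 * (a\<^sup>2 - 4 * a - 1) / (a\<^sup>2 * (a - 1) * (a + 1))"
  unfolding v5 using nz nz' by (simp add: divide_simps) (simp add: algebra_simps eval_nat_numeral)

lemma norm_uv: "(u ^ 5 - 11 - 1 / u ^ 5) * (v ^ 5 - 11 - 1 / v ^ 5) = S ^ 3"
  unfolding norm_u norm_v S_def by (simp add: power_mult_distrib power_divide eval_nat_numeral mult_ac)

text \<open>The index of X is the residue class modulo 5 of the exponents that occur.\<close>

definition "X1 = - 2 / ((a - 1) * u)"
definition "X2 = (a + 1)\<^sup>2 / ((a - 1) * u\<^sup>2)"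
definition "X3 = - (a - 1)\<^sup>2 * u\<^sup>2 / (a * (a + 1))"
definition "X4 = - 2 * a * u / (a + 1)"
text \<open>For the actual series this is 1/F (\<open>eta_quot_eq\<close>).\<close>

definition "G = (u - 1 - 1 / u) * (v - 1 - 1 / v)"

lemma G_eq: "G = 1 + (X1 + X2 + X3 + X4)"
proof -
  have uv: "u * v = a * (a + 1) / ((a - 1) * u\<^sup>2)"
  proof -
    have "u\<^sup>2 * (a - 1) * (u * v) = (u * v\<^sup>2) * (a + 1)" unfolding rel by (simp add: power2_eq_square)
    hence "(u * v) * ((a - 1) * u\<^sup>2) = a * (a + 1)" unfolding a[symmetric] by (simp add: mult_ac)
    thus ?thesis using nz nz' by (simp add: eq_divide_eq)
  qed
  have iv: "1 / v = (a + 1) / ((a - 1) * u\<^sup>2)" unfolding v_eq using nz nz' by (simp add: field_simps)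
  have iuv: "1 / (u * v) = (a - 1) * u\<^sup>2 / (a * (a + 1))" unfolding uv using nz nz' by (simp add: field_simps)
  have u_v: "u / v = (a + 1) / ((a - 1) * u)" unfolding v_eq using nz nz' by (simp add: field_simps power2_eq_square)
  have v_u: "v / u = u * (a - 1) / (a + 1)" unfolding v_eq using nz nz' by (simp add: power2_eq_square)
  \<comment> \<open>The nine monomials of the product, grouped by class: u and v have classes -1 and
    -2 modulo 5, so each bracket holds two monomials of one class.\<close>
  have "G = 1 + (1 / u - u / v) + (u * v + 1 / v) + (1 / (u * v) - v) + (- u - v / u)"
    unfolding G_def using nz by (simp add: field_simps)
  also have "1 / u - u / v = X1" unfolding u_v X1_def using nz nz' by (simp add: divide_simps)
  also have "u * v + 1 / v = X2" unfolding uv iv X2_def using nz nz' by (simp add: divide_simps) (simp add: algebra_simps power2_eq_square)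
  also have "1 / (u * v) - v = X3" unfolding iuv X3_def unfolding v_eq using nz nz' by (simp add: divide_simps) (simp add: algebra_simps power2_eq_square)
  also have "- u - v / u = X4" unfolding v_u X4_def using nz nz' by (simp add: divide_simps) (simp add: algebra_simps power2_eq_square)
  finally show ?thesis by (simp add: add_ac)
qed

definition "p = 4 * a / ((a - 1) * (a + 1))"
definition "r = - ((a - 1) * (a + 1)) / a"

text \<open>Up to factors rational in a, \<open>X1\<close> to \<open>X4\<close> are u^(-1), u^(-2),
  u^2, u. A monomial whose indices sum to a multiple of 5 therefore contains u only through u^5 and
  is rational in a. The following lemmas list those that enter the degree 5 equation and the powers
  of G.\<close>

lemma X14: "X1 * X4 = p" and X23: "X2 * X3 = r"
  unfolding X1_def X4_def X2_def X3_def p_def r_def using nz nz' by (simp_all add: divide_simps) (simp_all add: algebra_simps power2_eq_square)?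

lemma X113: "X1\<^sup>2 * X3 = - 4 / (a * (a + 1))"
  unfolding X1_def X3_def using nz nz' by (simp add: power_mult_distrib power_divide)

lemma X442: "X4\<^sup>2 * X2 = 4 * a\<^sup>2 / (a - 1)"
  unfolding X4_def X2_def using nz nz' by (simp add: power_mult_distrib power_divide)

lemma X221: "X2\<^sup>2 * X1 = - 2 * (a + 1)\<^sup>2 / (a * (a - 1))"
proof -
  have "X2\<^sup>2 * X1 = - 2 * (a + 1) ^ 4 / ((a - 1) ^ 3 * u ^ 5)"
    unfolding X1_def X2_def using nz nz' by (simp add: power_mult_distrib power_divide divide_simps) (simp add: eval_nat_numeral)
  also have "\<dots> = - 2 * (a + 1)\<^sup>2 / (a * (a - 1))"
    unfolding u5 using nz nz' by (simp add: divide_simps) (simp add: eval_nat_numeral)?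
  finally show ?thesis .
qed

lemma X334: "X3\<^sup>2 * X4 = - 2 * (a - 1)\<^sup>2 / (a + 1)"
proof -
  have "X3\<^sup>2 * X4 = - 2 * (a - 1) ^ 4 * u ^ 5 / (a * (a + 1) ^ 3)"
    unfolding X3_def X4_def using nz nz' by (simp add: power_mult_distrib power_divide divide_simps) (simp add: eval_nat_numeral)
  also have "\<dots> = - 2 * (a - 1)\<^sup>2 / (a + 1)"
    unfolding u5 using nz nz' by (simp add: divide_simps) (simp add: eval_nat_numeral)?
  finally show ?thesis .
qed

lemma X1112: "X1 ^ 3 * X2 = - 8 / (a * (a - 1)\<^sup>2)"
proof -
  have "X1 ^ 3 * X2 = - 8 * (a + 1)\<^sup>2 / ((a - 1) ^ 4 * u ^ 5)"
    unfolding X1_def X2_def using nz nz' by (simp add: power_mult_distrib power_divide divide_simps) (simp add: eval_nat_numeral)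
  also have "\<dots> = - 8 / (a * (a - 1)\<^sup>2)"
    unfolding u5 using nz nz' by (simp add: divide_simps) (simp add: eval_nat_numeral)?
  finally show ?thesis .
qed

lemma X2224: "X2 ^ 3 * X4 = - 2 * (a + 1) ^ 3 / (a - 1)"
proof -
  have "X2 ^ 3 * X4 = - 2 * a * (a + 1) ^ 5 / ((a - 1) ^ 3 * u ^ 5)"
    unfolding X2_def X4_def using nz nz' by (simp add: power_mult_distrib power_divide divide_simps) (simp add: eval_nat_numeral)
  also have "\<dots> = - 2 * (a + 1) ^ 3 / (a - 1)"
    unfolding u5 using nz nz' by (simp add: divide_simps) (simp add: eval_nat_numeral)?
  finally show ?thesis .
qed

lemma X3331: "X3 ^ 3 * X1 = 2 * (a - 1) ^ 3 / (a\<^sup>2 * (a + 1))"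
proof -
  have "X3 ^ 3 * X1 = 2 * (a - 1) ^ 5 * u ^ 5 / (a ^ 3 * (a + 1) ^ 3)"
    unfolding X1_def X3_def using nz nz' by (simp add: power_mult_distrib power_divide divide_simps) (simp add: eval_nat_numeral)
  also have "\<dots> = 2 * (a - 1) ^ 3 / (a\<^sup>2 * (a + 1))"
    unfolding u5 using nz nz' by (simp add: divide_simps) (simp add: eval_nat_numeral)?
  finally show ?thesis .
qed

lemma X4443: "X4 ^ 3 * X3 = 8 * a ^ 3 / (a + 1)\<^sup>2"
proof -
  have "X4 ^ 3 * X3 = 8 * a\<^sup>2 * (a - 1)\<^sup>2 * u ^ 5 / (a + 1) ^ 4"
    unfolding X4_def X3_def using nz nz' by (simp add: power_mult_distrib power_divide divide_simps) (simp add: eval_nat_numeral)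
  also have "\<dots> = 8 * a ^ 3 / (a + 1)\<^sup>2"
    unfolding u5 using nz nz' by (simp add: divide_simps) (simp add: eval_nat_numeral)?
  finally show ?thesis .
qed

lemma X1_5: "X1 ^ 5 = - 32 / (a * (a - 1) ^ 3 * (a + 1)\<^sup>2)"
proof -
  have "X1 ^ 5 = - 32 / ((a - 1) ^ 5 * u ^ 5)" unfolding X1_def by (simp add: power_mult_distrib power_divide)
  also have "\<dots> = - 32 / (a * (a - 1) ^ 3 * (a + 1)\<^sup>2)"
    unfolding u5 using nz nz' by (simp add: divide_simps) (simp add: eval_nat_numeral)?
  finally show ?thesis .
qed

lemma X2_5: "X2 ^ 5 = (a + 1) ^ 6 / (a\<^sup>2 * (a - 1))"
proof -
  have "X2 ^ 5 = (a + 1) ^ 10 / ((a - 1) ^ 5 * (u ^ 5)\<^sup>2)"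
    unfolding X2_def by (simp add: power_mult_distrib power_divide flip: power_mult)
  also have "\<dots> = (a + 1) ^ 6 / (a\<^sup>2 * (a - 1))"
    unfolding u5 using nz nz' by (simp add: power_mult_distrib power_divide divide_simps) (simp add: eval_nat_numeral)?
  finally show ?thesis .
qed

lemma X3_5: "X3 ^ 5 = - ((a - 1) ^ 6) / (a ^ 3 * (a + 1))"
proof -
  have "X3 ^ 5 = - ((a - 1) ^ 10) * (u ^ 5)\<^sup>2 / (a ^ 5 * (a + 1) ^ 5)"
    unfolding X3_def by (simp add: power_mult_distrib power_divide flip: power_mult)
  also have "\<dots> = - ((a - 1) ^ 6) / (a ^ 3 * (a + 1))"
    unfolding u5 using nz nz' by (simp add: power_mult_distrib power_divide divide_simps) (simp add: eval_nat_numeral)?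
  finally show ?thesis .
qed

lemma X4_5: "X4 ^ 5 = - 32 * a ^ 6 / ((a - 1)\<^sup>2 * (a + 1) ^ 3)"
proof -
  have "X4 ^ 5 = - 32 * a ^ 5 * u ^ 5 / (a + 1) ^ 5" unfolding X4_def by (simp add: power_mult_distrib power_divide)
  also have "\<dots> = - 32 * a ^ 6 / ((a - 1)\<^sup>2 * (a + 1) ^ 3)"
    unfolding u5 using nz nz' by (simp add: divide_simps) (simp add: eval_nat_numeral)?
  finally show ?thesis .
qed

text \<open>
  For free h, the difference of the two sides is the product of h - (w x1 + w^2 x2 + w^3 x3 + w^4 x4)
  over the fifth roots of unity w; the factor at w = 1 vanishes.
\<close>

lemma circulant_identity:
  fixes x1 x2 x3 x4 :: "'b::comm_ring_1"
  defines "h \<equiv> x1 + x2 + x3 + x4"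
  shows "h ^ 5 - 5 * (x1 * x4 + x2 * x3) * h ^ 3 - 5 * (x1\<^sup>2 * x3 + x2\<^sup>2 * x1 + x3\<^sup>2 * x4 + x4\<^sup>2 * x2) * h\<^sup>2
    + 5 * ((x1 * x4)\<^sup>2 + (x2 * x3)\<^sup>2 - (x1 * x4) * (x2 * x3) - (x1 ^ 3 * x2 + x2 ^ 3 * x4 + x3 ^ 3 * x1 + x4 ^ 3 * x3)) * h
    = x1 ^ 5 + x2 ^ 5 + x3 ^ 5 + x4 ^ 5
      - 5 * (x1 * x4 - x2 * x3) * (x1\<^sup>2 * x3 + x4\<^sup>2 * x2 - x2\<^sup>2 * x1 - x3\<^sup>2 * x4)"
  unfolding h_def by (simp add: algebra_simps eval_nat_numeral)

text \<open>With x = a - 1/a one finds S = x - 3 - 4/x, p = 4/x and r = -x. The substitution x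
  \<mapsto> -4/x fixes S and exchanges p and r; single monomials are not functions of S, but these
  cyclic sums are polynomials in S.\<close>

lemma S2: "p + r = - (S + 3)"
  unfolding p_def r_def S_def using nz nz' by (simp add: divide_simps) (simp add: algebra_simps eval_nat_numeral)

lemma pr: "p * r = - 4"
  unfolding p_def r_def using nz nz' by (simp add: divide_simps)

lemma S3: "X1\<^sup>2 * X3 + X2\<^sup>2 * X1 + X3\<^sup>2 * X4 + X4\<^sup>2 * X2 = 2 * S + 14"
  unfolding X113 X442 X221 X334 S_def using nz nz'
  by (simp add: divide_simps) (simp add: algebra_simps eval_nat_numeral)

lemma S4: "X1 ^ 3 * X2 + X2 ^ 3 * X4 + X3 ^ 3 * X1 + X4 ^ 3 * X3 = - 2 * S\<^sup>2 - 12 * S - 66"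
  unfolding X1112 X2224 X3331 X4443 S_def using nz nz'
  by (simp add: divide_simps power_divide power_mult_distrib) (simp add: algebra_simps eval_nat_numeral)

lemma S5: "X1 ^ 5 + X2 ^ 5 + X3 ^ 5 + X4 ^ 5 - 5 * (p - r) * (X1\<^sup>2 * X3 + X4\<^sup>2 * X2 - X2\<^sup>2 * X1 - X3\<^sup>2 * X4)
  = S ^ 3 - 15 * S\<^sup>2 - 105 * S - 521"
  unfolding X1_5 X2_5 X3_5 X4_5 X113 X442 X221 X334 S_def p_def r_def using nz nz'
  by (simp add: divide_simps power_divide power_mult_distrib) (simp add: algebra_simps eval_nat_numeral)

lemma modular_equation:
  "G ^ 5 - 5 * G ^ 4 + 5 * (S + 5) * G ^ 3 - 25 * (S + 5) * G\<^sup>2 + 5 * (3 * S\<^sup>2 + 25 * S + 125) * G - S ^ 3 = 0"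
proof -
  define h where "h = X1 + X2 + X3 + X4"
  have G: "G = 1 + h" by (simp add: G_eq h_def)
  have "p\<^sup>2 + r\<^sup>2 = (p + r)\<^sup>2 - 2 * (p * r)" by (simp add: algebra_simps power2_eq_square)
  \<comment> \<open>The unsimplified \<open>- - 4\<close> is \<open>- p * r\<close> after rewriting
    with \<open>pr\<close>, the shape in which it occurs in
    \<open>circulant_identity\<close>.\<close>
  hence pr2: "p\<^sup>2 + r\<^sup>2 - - 4 = (- (S + 3))\<^sup>2 - 3 * - 4" unfolding S2 pr by simp
  have c: "h ^ 5 + 5 * (S + 3) * h ^ 3 - 5 * (2 * S + 14) * h\<^sup>2 + 5 * (3 * S\<^sup>2 + 18 * S + 87) * h
     = S ^ 3 - 15 * S\<^sup>2 - 105 * S - 521"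
  proof -
    have "h ^ 5 + 5 * (S + 3) * h ^ 3 - 5 * (2 * S + 14) * h\<^sup>2 + 5 * (3 * S\<^sup>2 + 18 * S + 87) * h
       = h ^ 5 - 5 * (- (S + 3)) * h ^ 3 - 5 * (2 * S + 14) * h\<^sup>2
         + 5 * ((- (S + 3))\<^sup>2 - 3 * - 4 - (- 2 * S\<^sup>2 - 12 * S - 66)) * h"
      by (simp add: algebra_simps power2_eq_square)
    also have "\<dots> = S ^ 3 - 15 * S\<^sup>2 - 105 * S - 521"
      using circulant_identity[of X1 X2 X3 X4]
      unfolding X14 X23 S3 S4 S5 pr2 S2 pr h_def[symmetric] .
    finally show ?thesis .
  qed
  have "G ^ 5 - 5 * G ^ 4 + 5 * (S + 5) * G ^ 3 - 25 * (S + 5) * G\<^sup>2 + 5 * (3 * S\<^sup>2 + 25 * S + 125) * G - S ^ 3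
     = (h ^ 5 + 5 * (S + 3) * h ^ 3 - 5 * (2 * S + 14) * h\<^sup>2 + 5 * (3 * S\<^sup>2 + 18 * S + 87) * h)
       - (S ^ 3 - 15 * S\<^sup>2 - 105 * S - 521)"
    unfolding G by (simp add: algebra_simps eval_nat_numeral)
  thus ?thesis unfolding c by simp
qed

end

subsection \<open>The operator that keeps the exponents divisible by 5\<close>

abbreviation V5 :: "'a::zero fls \<Rightarrow> 'a fls" where "V5 f \<equiv> fls_compose_power f 5"

definition U5 :: "'a::zero fls \<Rightarrow> 'a fls" where
  "U5 f = Abs_fls (\<lambda>n. f $$ (5 * n))"

lemma U5_nth [simp]: "U5 f $$ n = f $$ (5 * n)"
  unfolding U5_def
proof (rule nth_Abs_fls_lower_bound[of "min 0 (fls_subdegree f)"], intro allI impI)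
  fix n :: int assume "n < min 0 (fls_subdegree f)"
  thus "f $$ (5 * n) = 0" by (intro fls_eq0_below_subdegree) auto
qed

lemma U5_add: "U5 (f + g) = U5 f + U5 g" for f :: "'a::monoid_add fls"
  by (simp add: fls_eq_iff)

lemma U5_0 [simp]: "U5 0 = 0"
  by (simp add: fls_eq_iff)

lemma U5_V5 [simp]: "U5 (V5 f) = f"
  by (simp add: fls_eq_iff fls_nth_compose_power)

lemma U5_graded: "graded i f \<Longrightarrow> i mod 5 \<noteq> 0 \<Longrightarrow> U5 f = 0"
  by (auto simp: fls_eq_iff graded_def)

lemma graded_0_eq_V5: "graded 0 f \<Longrightarrow> V5 (U5 f) = f"
  by (auto simp: fls_eq_iff fls_nth_compose_power graded_def dvd_eq_mod_eq_0)

definition part :: "int \<Rightarrow> 'a::zero fls \<Rightarrow> 'a fls" where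
  "part i f = Abs_fls (\<lambda>n. if n mod 5 = i then f $$ n else 0)"

lemma part_nth: "part i f $$ n = (if n mod 5 = i then f $$ n else 0)"
  unfolding part_def
proof (rule nth_Abs_fls_lower_bound[of "fls_subdegree f"], intro allI impI)
  fix n :: int assume "n < fls_subdegree f"
  thus "(if n mod 5 = i then f $$ n else 0) = 0" by auto
qed

lemma graded_part: "graded i (part i f)"
  by (auto simp: graded_def part_nth)

lemma part_sum: "f = part 0 f + part 1 f + part 2 f + part 3 f + part 4 f" for f :: "'a::monoid_add fls"
proof (rule fls_eqI)
  fix n :: int
  have "n mod 5 \<in> {0..4}" by simp
  thus "f $$ n = (part 0 f + part 1 f + part 2 f + part 3 f + part 4 f) $$ n"
    unfolding int_interval_0_4 by (auto simp: part_nth)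
qed

text \<open>\<open>V5 g\<close> has only exponents divisible by 5, so the other classes of f
  contribute nothing; the class 0 part of f is itself in the image of \<open>V5\<close>, which is
  multiplicative.\<close>

lemma U5_mult_V5: "U5 (f * V5 g) = U5 f * g" for f g :: "'a::idom fls"
proof -
  have k: "U5 (part i f * V5 g) = 0" if "i \<in> {1, 2, 3, 4}" for i
  proof (rule U5_graded)
    show "graded i (part i f * V5 g)" by (rule graded_mult'[OF graded_part graded_compose_power]) simp
    show "i mod 5 \<noteq> 0" using that by auto
  qed
  have "f * V5 g = part 0 f * V5 g + part 1 f * V5 g + part 2 f * V5 g + part 3 f * V5 g + part 4 f * V5 g"
    by (subst part_sum[of f]) (simp add: algebra_simps)
  hence "U5 (f * V5 g) = U5 (part 0 f * V5 g)"
    by (simp add: U5_add k)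
  also have "part 0 f * V5 g = V5 (U5 (part 0 f) * g)"
    unfolding fls_compose_power_mult graded_0_eq_V5[OF graded_part] ..
  also have "U5 \<dots> = U5 (part 0 f) * g" by (rule U5_V5)
  also have "U5 (part 0 f) = U5 f" by (simp add: fls_eq_iff part_nth)
  finally show ?thesis .
qed

lemma U5_V5_mult: "U5 (V5 g * f) = g * U5 f" for f g :: "'a::idom fls"
  using U5_mult_V5[of f g] by (simp add: mult.commute)

lemma graded_X_intpow: "graded i (fls_X_intpow i :: 'a::zero_neq_one fls)"
  by (auto simp: graded_def)

text \<open>A shift by q^(-i) moves f into class 0, where it has the form \<open>V5 g\<close>; there
  inversion can be done on g.\<close>

lemma graded_inverse:
  fixes f :: "'a::field fls"
  assumes "graded i f" shows "graded (- i) (1 / f)"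
proof (cases "f = 0")
  case True
  thus ?thesis by (simp add: graded_def)
next
  case False
  define g where "g = U5 (fls_X_intpow (- i) * f)"
  have "graded 0 (fls_X_intpow (- i) * f)"
    by (rule graded_mult'[OF graded_X_intpow assms]) simp
  hence "V5 g = fls_X_intpow (- i) * f" unfolding g_def by (rule graded_0_eq_V5)
  moreover have "fls_X_intpow (- i) \<noteq> (0 :: 'a fls)" by (rule fls_X_intpow_nonzero)
  ultimately have "1 / f = fls_X_intpow (- i) * (1 / V5 g)" using False by simp
  also have "1 / V5 g = V5 (1 / g)" by (simp add: fls_compose_power_1_divide)
  finally show ?thesis using graded_mult'[OF graded_X_intpow graded_compose_power[of "1 / g"], of "- i" "- i"] by simp
qed

lemma graded_divide: "graded i f \<Longrightarrow> graded j g \<Longrightarrow> k mod 5 = (i - j) mod 5 \<Longrightarrow> graded k (f / g)"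
  for f g :: "'a::field fls"
  using graded_mult'[OF _ graded_inverse, of i f j g k] by simp

lemma U5_mult_graded:
  fixes f0 g0 :: "'a::comm_ring_1 fls"
  assumes f: "graded 0 f0" "graded 1 f1" "graded 2 f2" "graded 3 f3" "graded 4 f4"
  assumes g: "graded 0 g0" "graded 1 g1" "graded 2 g2" "graded 3 g3" "graded 4 g4"
  shows "U5 ((f0 + f1 + f2 + f3 + f4) * (g0 + g1 + g2 + g3 + g4))
       = U5 (f0 * g0 + f1 * g4 + f2 * g3 + f3 * g2 + f4 * g1)"
proof -
  have k: "U5 (x * y) = 0" if "graded i x" "graded j y" "(i + j) mod 5 \<noteq> 0" for i j and x y :: "'a fls"
    using U5_graded[OF graded_mult[OF that(1,2)] that(3)] .
  show ?thesis
    by (simp add: distrib_left distrib_right U5_add k[OF f(1) g(2)] k[OF f(1) g(3)] k[OF f(1) g(4)] k[OF f(1) g(5)]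
       k[OF f(2) g(1)] k[OF f(2) g(2)] k[OF f(2) g(3)] k[OF f(2) g(4)]
       k[OF f(3) g(1)] k[OF f(3) g(2)] k[OF f(3) g(3)] k[OF f(3) g(5)]
       k[OF f(4) g(1)] k[OF f(4) g(2)] k[OF f(4) g(4)] k[OF f(4) g(5)]
       k[OF f(5) g(1)] k[OF f(5) g(3)] k[OF f(5) g(4)] k[OF f(5) g(5)])
qed

text \<open>Only monomials with index sum divisible by 5 survive, with their multinomial
  coefficients. The third and fourth powers are assembled from the graded components
  \<open>y0\<close> to \<open>y4\<close> of h^2.\<close>

lemma U5_powers_graded:
  fixes x1 :: "'a::comm_ring_1 fls"
  assumes x: "graded 1 x1" "graded 2 x2" "graded 3 x3" "graded 4 x4"
  defines "h \<equiv> x1 + x2 + x3 + x4"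
  shows "U5 h = 0"
    and "U5 (h\<^sup>2) = U5 (2 * (x1 * x4 + x2 * x3))"
    and "U5 (h ^ 3) = U5 (3 * (x1\<^sup>2 * x3 + x2\<^sup>2 * x1 + x3\<^sup>2 * x4 + x4\<^sup>2 * x2))"
    and "U5 (h ^ 4) = U5 (6 * ((x1 * x4)\<^sup>2 + (x2 * x3)\<^sup>2) + 24 * ((x1 * x4) * (x2 * x3))
           + 4 * (x1 ^ 3 * x2 + x2 ^ 3 * x4 + x3 ^ 3 * x1 + x4 ^ 3 * x3))"
proof -
  show "U5 h = 0"
    unfolding h_def by (simp add: U5_add U5_graded[OF x(1)] U5_graded[OF x(2)] U5_graded[OF x(3)] U5_graded[OF x(4)])
  have z: "graded 0 (0 :: 'a fls)" by (simp add: graded_def)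
  have h: "h = 0 + x1 + x2 + x3 + x4" by (simp add: h_def)
  have m: "graded k (y * z)" if "graded i y" "graded j z" "k mod 5 = (i + j) mod 5" for i j k and y z :: "'a fls"
    using graded_mult'[OF that] .
  define y0 y1 y2 y3 y4 where "y0 = 2 * (x1 * x4) + 2 * (x2 * x3)" and "y1 = 2 * (x2 * x4) + x3 * x3"
    and "y2 = x1 * x1 + 2 * (x3 * x4)" and "y3 = 2 * (x1 * x2) + x4 * x4" and "y4 = x2 * x2 + 2 * (x1 * x3)"
  have y: "graded 0 y0" "graded 1 y1" "graded 2 y2" "graded 3 y3" "graded 4 y4"
    unfolding y0_def y1_def y2_def y3_def y4_def
    by (intro graded_add graded_numeral_mult; 
        (rule m[OF x(1) x(4)] m[OF x(2) x(3)] m[OF x(2) x(4)] m[OF x(3) x(3)] m[OF x(1) x(1)]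
          m[OF x(3) x(4)] m[OF x(1) x(2)] m[OF x(4) x(4)] m[OF x(2) x(2)] m[OF x(1) x(3)]), simp)+
  have h2: "h\<^sup>2 = y0 + y1 + y2 + y3 + y4"
    unfolding h_def y0_def y1_def y2_def y3_def y4_def by (simp add: algebra_simps power2_eq_square)
  have "U5 (h\<^sup>2) = U5 y0"
    unfolding h2 by (simp add: U5_add U5_graded[OF y(2)] U5_graded[OF y(3)] U5_graded[OF y(4)] U5_graded[OF y(5)])
  also have "y0 = 2 * (x1 * x4 + x2 * x3)" by (simp add: y0_def algebra_simps)
  finally show "U5 (h\<^sup>2) = U5 (2 * (x1 * x4 + x2 * x3))" .
  have "U5 (h ^ 3) = U5 (h * h\<^sup>2)" by (simp add: eval_nat_numeral)
  also have "\<dots> = U5 (0 * y0 + x1 * y4 + x2 * y3 + x3 * y2 + x4 * y1)"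
    unfolding h2 unfolding h by (rule U5_mult_graded[OF z x y])
  also have "0 * y0 + x1 * y4 + x2 * y3 + x3 * y2 + x4 * y1 = 3 * (x1\<^sup>2 * x3 + x2\<^sup>2 * x1 + x3\<^sup>2 * x4 + x4\<^sup>2 * x2)"
    unfolding y0_def y1_def y2_def y3_def y4_def by (simp add: algebra_simps power2_eq_square)
  finally show "U5 (h ^ 3) = U5 (3 * (x1\<^sup>2 * x3 + x2\<^sup>2 * x1 + x3\<^sup>2 * x4 + x4\<^sup>2 * x2))" .
  have "U5 (h ^ 4) = U5 (h\<^sup>2 * h\<^sup>2)" by (simp add: eval_nat_numeral mult_ac)
  also have "\<dots> = U5 (y0 * y0 + y1 * y4 + y2 * y3 + y3 * y2 + y4 * y1)"
    unfolding h2 by (rule U5_mult_graded[OF y y])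
  also have "y0 * y0 + y1 * y4 + y2 * y3 + y3 * y2 + y4 * y1 = 6 * ((x1 * x4)\<^sup>2 + (x2 * x3)\<^sup>2) + 24 * ((x1 * x4) * (x2 * x3))
           + 4 * (x1 ^ 3 * x2 + x2 ^ 3 * x4 + x3 ^ 3 * x1 + x4 ^ 3 * x3)"
    unfolding y0_def y1_def y2_def y3_def y4_def by (simp add: algebra_simps eval_nat_numeral)
  finally show "U5 (h ^ 4) = U5 (6 * ((x1 * x4)\<^sup>2 + (x2 * x3)\<^sup>2) + 24 * ((x1 * x4) * (x2 * x3))
           + 4 * (x1 ^ 3 * x2 + x2 ^ 3 * x4 + x3 ^ 3 * x1 + x4 ^ 3 * x3))" .
qed

section \<open>The algebraic identities specialised to q-series\<close>

interpretation rr: rr_param rru rrv rra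
proof
  show "rra = rru * rrv\<^sup>2" by (simp add: rra_def)
  show "rru\<^sup>2 * (rra - 1) = rrv * (rra + 1)" by (rule rr_relations)
qed (use rra_neq in simp_all)

lemma graded_rr: "graded (-1) rru" "graded (-2) rrv" "graded 0 rra"
proof -
  show u: "graded (-1) rru" unfolding rru_def by (rule graded_divide[OF graded_dissection(1,2)]) simp
  show v: "graded (-2) rrv" using graded_compose_power_2[OF u] unfolding V2_rru by simp
  show "graded 0 rra" unfolding rra_def power2_eq_square
    by (rule graded_mult'[OF u graded_mult[OF v v]]) simp
qed

lemma graded_rr_X: "graded 1 rr.X1" "graded 2 rr.X2" "graded 3 rr.X3" "graded 4 rr.X4"
proof -
  note u = graded_rr(1) note a = graded_rr(3)
  have a1: "graded 0 (rra - 1)" "graded 0 (rra + 1)" using a by auto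
  have u2: "graded (-2) (rru\<^sup>2)" unfolding power2_eq_square by (rule graded_mult'[OF u u]) simp
  have sq: "graded 0 (x\<^sup>2)" if "graded 0 x" for x :: "complex fls"
    unfolding power2_eq_square by (rule graded_mult'[OF that that]) simp
  show "graded 1 rr.X1" unfolding rr.X1_def
    by (rule graded_divide[OF graded_uminus[OF graded_numeral] graded_mult[OF a1(1) u]]) simp
  show "graded 2 rr.X2" unfolding rr.X2_def
    by (rule graded_divide[OF sq[OF a1(2)] graded_mult[OF a1(1) u2]]) simp
  show "graded 3 rr.X3" unfolding rr.X3_def
    by (rule graded_divide[OF graded_mult[OF graded_uminus[OF sq[OF a1(1)]] u2] graded_mult[OF a a1(2)]]) simp
  have "graded 0 (- 2 * rra)" by (rule graded_mult'[OF graded_uminus[OF graded_numeral] a]) simp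
  from graded_mult[OF this u] show "graded 4 rr.X4" unfolding rr.X4_def
    by (rule graded_divide[OF _ a1(2)]) simp
qed

text \<open>The function t. It has degree 2 on the modular curve of level 10, and is a Hauptmodul
  after division by the involution at 2.\<close>

definition hauptmodul :: "complex fls" where
  "hauptmodul = fls_X * (euler_fls 5 * euler_fls 10)\<^sup>2 / (euler_fls 1 * euler_fls 2)\<^sup>2"

definition eta_quot :: "complex fls" where
  "eta_quot = fls_X ^ 3 * (euler_fls 25 * euler_fls 50) / (euler_fls 1 * euler_fls 2)"

lemma hauptmodul_nonzero [simp]: "hauptmodul \<noteq> 0" by (simp add: hauptmodul_def)
lemma eta_quot_nonzero [simp]: "eta_quot \<noteq> 0" by (simp add: eta_quot_def)

lemma V5_X: "V5 fls_X = (fls_X ^ 5 :: complex fls)"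
  by (simp flip: fls_X_power_int)

lemma fls_compose_power_divide:
  fixes f :: "'a::field fls"
  assumes "d > 0" shows "fls_compose_power (f / g) d = fls_compose_power f d / fls_compose_power g d"
  using fls_compose_power_mult[of f "1 / g" d] fls_compose_power_1_divide[OF assms, of g] by simp

lemma V5_hauptmodul: "V5 hauptmodul = fls_X ^ 5 * (euler_fls 25 * euler_fls 50)\<^sup>2 / (euler_fls 5 * euler_fls 10)\<^sup>2"
  unfolding hauptmodul_def by (simp add: fls_compose_power_divide V5_X euler_fls_compose)

lemma V5_hauptmodul_nonzero [simp]: "V5 hauptmodul \<noteq> 0"
  unfolding V5_hauptmodul by simp

lemma eta_quot_squared: "eta_quot\<^sup>2 = hauptmodul * V5 hauptmodul"
  unfolding V5_hauptmodul unfolding eta_quot_def hauptmodul_def by (simp add: field_simps flip: power_add power_Suc power_mult)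

lemma eta_quot_eq: "rr.G = 1 / eta_quot"
proof -
  have "rr.G * (dC * V2 dC) = euler_fls 1 * euler_fls 2"
    unfolding rr.G_def euler_fls_1_rr euler_fls_2_rr by (simp only: mult_ac)
  moreover have "dC * V2 dC = fls_X ^ 3 * (euler_fls 25 * euler_fls 50)"
    unfolding V2_dC unfolding dC_def by (simp add: eval_nat_numeral)
  ultimately show ?thesis unfolding eta_quot_def by (simp add: eq_divide_eq)
qed

text \<open>The cofactor f^2 + f g + g^2 of f - g has constant term 3, so it is not zero; this
  selects one of the three complex cube roots.\<close>

lemma fps_cube_eq:
  fixes f g :: "complex fps"
  assumes "f ^ 3 = g ^ 3" "f $ 0 = 1" "g $ 0 = 1"
  shows "f = g"
proof -
  have "(f - g) * (f * f + f * g + g * g) = f ^ 3 - g ^ 3" by (simp add: algebra_simps eval_nat_numeral)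
  hence "(f - g) * (f * f + f * g + g * g) = 0" using assms by simp
  moreover have "(f * f + f * g + g * g) $ 0 = 3" using assms by simp
  hence "f * f + f * g + g * g \<noteq> 0" by (metis fps_zero_nth zero_neq_numeral)
  ultimately show ?thesis by simp
qed

lemma rr_S_cubed: "rr.S ^ 3 = (1 / V5 hauptmodul) ^ 3"
proof -
  have u: "rru ^ 5 - 11 - 1 / rru ^ 5 = euler_fls 5 ^ 6 / (dC ^ 5 * euler_fls 25)"
    using norm_rr by (simp add: eq_divide_eq mult_ac)
  have v: "rrv ^ 5 - 11 - 1 / rrv ^ 5 = euler_fls 10 ^ 6 / (V2 dC ^ 5 * euler_fls 50)"
    using norm_rr2 by (simp add: eq_divide_eq mult_ac)
  have "rr.S ^ 3 = euler_fls 5 ^ 6 * euler_fls 10 ^ 6 / (fls_X ^ 15 * euler_fls 25 ^ 6 * euler_fls 50 ^ 6)"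
    unfolding rr.norm_uv[symmetric] u v unfolding V2_dC unfolding dC_def
    by (simp add: power_mult_distrib eval_nat_numeral mult_ac)
  also have "\<dots> = (1 / V5 hauptmodul) ^ 3"
    unfolding V5_hauptmodul by (simp add: power_mult_distrib power_divide flip: power_mult)
  finally show ?thesis .
qed

text \<open>The norms only give equality of cubes. Multiplying both sides by the common denominator
  \<open>R\<close> turns them into power series \<open>Z\<close> and \<open>Y\<close> with constant
  term 1, to which \<open>fps_cube_eq\<close> applies.\<close>

lemma rr_S: "rr.S = 1 / V5 hauptmodul"
proof -
  define N D where "N = rra_num" and "D = rra_den"
  define Q :: "complex fps" where "Q = fps_X ^ 5"
  define f5 f10 f25 f50 :: "complex fps" where "f5 = euler oo fps_X ^ 5" and "f10 = euler oo fps_X ^ 10"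
    and "f25 = euler oo fps_X ^ 25" and "f50 = euler oo fps_X ^ 50"
  note c = fls_times_fps_to_fls fps_to_fls_power
  define Y where "Y = (f5 * f10)\<^sup>2 * (N * D * (N - Q * D) * (N + Q * D))"
  define Z where "Z = (f25 * f50)\<^sup>2 * ((N\<^sup>2 + N * Q * D - Q\<^sup>2 * D\<^sup>2) * (N\<^sup>2 - 4 * (N * Q * D) - Q\<^sup>2 * D\<^sup>2))"
  have Q: "Q $ 0 = 0" by (simp add: Q_def)
  have Y0: "Y $ 0 = 1" unfolding Y_def 
    by (simp add: N_def D_def Q power2_eq_square f5_def f10_def)
  have Z0: "Z $ 0 = 1" unfolding Z_def 
    by (simp add: N_def D_def Q power2_eq_square f25_def f50_def)
  define n d q where "n = fps_to_fls N" and "d = fps_to_fls D" and "q = fps_to_fls Q"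
  have "N \<noteq> 0" "D \<noteq> 0"
    using rra_num_den_nth_0 unfolding N_def D_def by (metis fps_zero_nth zero_neq_one)+
  hence nz: "n \<noteq> 0" "d \<noteq> 0" "q \<noteq> 0"
    unfolding n_def d_def q_def Q_def by simp_all
  have a: "rra = n / (q * d)"
    unfolding rra_eq n_def d_def q_def N_def D_def Q_def by (simp add: fps_to_fls_power)
  have a1: "rra - 1 = (n - q * d) / (q * d)" "rra + 1 = (n + q * d) / (q * d)"
    unfolding a using nz by (simp_all add: field_simps)
  have nz2: "n - q * d \<noteq> 0" "n + q * d \<noteq> 0"
    using rr.nz' unfolding a1 by auto
  have S: "rr.S = ((n\<^sup>2 + n * q * d - q\<^sup>2 * d\<^sup>2) * (n\<^sup>2 - 4 * (n * q * d) - q\<^sup>2 * d\<^sup>2)) / (q * (n * d * (n - q * d) * (n + q * d)))"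
  proof -
    have "rra\<^sup>2 + rra - 1 = (n\<^sup>2 + n * q * d - q\<^sup>2 * d\<^sup>2) / (q\<^sup>2 * d\<^sup>2)"
      unfolding a using nz by (simp add: field_simps power2_eq_square)
    moreover have "rra\<^sup>2 - 4 * rra - 1 = (n\<^sup>2 - 4 * (n * q * d) - q\<^sup>2 * d\<^sup>2) / (q\<^sup>2 * d\<^sup>2)"
      unfolding a using nz by (simp add: field_simps power2_eq_square)
    ultimately show ?thesis unfolding rr.S_def a1 unfolding a using nz nz2
      by (simp add: divide_simps) (simp add: power2_eq_square mult_ac)?
  qed
  have T: "1 / V5 hauptmodul = fps_to_fls ((f5 * f10)\<^sup>2) / (q * fps_to_fls ((f25 * f50)\<^sup>2))"
    unfolding V5_hauptmodul by (simp add: c f5_def f10_def f25_def f50_def euler_fls_def q_def Q_def)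
  have ff: "fps_to_fls ((f25 * f50)\<^sup>2) \<noteq> 0" "fps_to_fls ((f5 * f10)\<^sup>2) \<noteq> 0"
    using euler_fls_nonzero[of 25] euler_fls_nonzero[of 50] euler_fls_nonzero[of 5] euler_fls_nonzero[of 10] 
    by (simp_all add: f5_def f10_def f25_def f50_def euler_fls_def)
  have Y: "fps_to_fls Y = fps_to_fls ((f5 * f10)\<^sup>2) * (n * d * (n - q * d) * (n + q * d))"
    unfolding Y_def by (simp add: c n_def d_def q_def)
  have Z: "fps_to_fls Z = fps_to_fls ((f25 * f50)\<^sup>2) * ((n\<^sup>2 + n * q * d - q\<^sup>2 * d\<^sup>2) * (n\<^sup>2 - 4 * (n * q * d) - q\<^sup>2 * d\<^sup>2))"
    unfolding Z_def by (simp add: c n_def d_def q_def)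
  define R where "R = fps_to_fls ((f25 * f50)\<^sup>2) * (q * (n * d * (n - q * d) * (n + q * d)))"
  have ZR: "fps_to_fls Z = rr.S * R" unfolding Z S R_def using nz nz2 by simp
  have YR: "fps_to_fls Y = (1 / V5 hauptmodul) * R" unfolding Y T R_def using nz ff by simp
  have "fps_to_fls (Z ^ 3) = fps_to_fls (Y ^ 3)"
    unfolding fps_to_fls_power ZR YR power_mult_distrib rr_S_cubed ..
  hence "Z ^ 3 = Y ^ 3" by (simp only: fps_to_fls_eq_iff)
  hence "Z = Y" by (rule fps_cube_eq[OF _ Z0 Y0])
  hence "rr.S * R = (1 / V5 hauptmodul) * R" using ZR YR by simp
  moreover have "R \<noteq> 0" unfolding R_def using nz nz2 ff by simp
  ultimately show ?thesis by (metis mult_right_cancel)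
qed

text \<open>\<open>rr.modular_equation\<close> with G = 1/F and S = 1/T, multiplied by F^5 T^3. The
  coefficients become polynomials in T = t(q^5), and such factors pass through
  \<open>U5\<close>.\<close>

theorem eta_quot_modular_equation:
  fixes T defines "T \<equiv> V5 hauptmodul"
  shows "eta_quot ^ 5 = (15 * T + 125 * T\<^sup>2 + 625 * T ^ 3) * eta_quot ^ 4 - (25 * T\<^sup>2 + 125 * T ^ 3) * eta_quot ^ 3
    + (5 * T\<^sup>2 + 25 * T ^ 3) * eta_quot\<^sup>2 - 5 * T ^ 3 * eta_quot + T ^ 3"
proof -
  have T: "T \<noteq> 0" by (simp add: T_def)
  have "(1 / eta_quot) ^ 5 - 5 * (1 / eta_quot) ^ 4 + 5 * (1 / T + 5) * (1 / eta_quot) ^ 3 - 25 * (1 / T + 5) * (1 / eta_quot)\<^sup>2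
     + 5 * (3 * (1 / T)\<^sup>2 + 25 * (1 / T) + 125) * (1 / eta_quot) - (1 / T) ^ 3 = 0"
    using rr.modular_equation unfolding eta_quot_eq rr_S T_def .
  hence "eta_quot ^ 5 * T ^ 3 * ((1 / eta_quot) ^ 5 - 5 * (1 / eta_quot) ^ 4 + 5 * (1 / T + 5) * (1 / eta_quot) ^ 3 - 25 * (1 / T + 5) * (1 / eta_quot)\<^sup>2
     + 5 * (3 * (1 / T)\<^sup>2 + 25 * (1 / T) + 125) * (1 / eta_quot) - (1 / T) ^ 3) = 0" by simp
  also have "eta_quot ^ 5 * T ^ 3 * ((1 / eta_quot) ^ 5 - 5 * (1 / eta_quot) ^ 4 + 5 * (1 / T + 5) * (1 / eta_quot) ^ 3 - 25 * (1 / T + 5) * (1 / eta_quot)\<^sup>2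
     + 5 * (3 * (1 / T)\<^sup>2 + 25 * (1 / T) + 125) * (1 / eta_quot) - (1 / T) ^ 3)
     = ((15 * T + 125 * T\<^sup>2 + 625 * T ^ 3) * eta_quot ^ 4 - (25 * T\<^sup>2 + 125 * T ^ 3) * eta_quot ^ 3
    + (5 * T\<^sup>2 + 25 * T ^ 3) * eta_quot\<^sup>2 - 5 * T ^ 3 * eta_quot + T ^ 3) - eta_quot ^ 5"
  proof -
    have "e ^ 5 * T ^ 3 * ((1 / e) ^ 5 - 5 * (1 / e) ^ 4 + 5 * (1 / T + 5) * (1 / e) ^ 3 - 25 * (1 / T + 5) * (1 / e)\<^sup>2
     + 5 * (3 * (1 / T)\<^sup>2 + 25 * (1 / T) + 125) * (1 / e) - (1 / T) ^ 3)
     = ((15 * T + 125 * T\<^sup>2 + 625 * T ^ 3) * e ^ 4 - (25 * T\<^sup>2 + 125 * T ^ 3) * e ^ 3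
    + (5 * T\<^sup>2 + 25 * T ^ 3) * e\<^sup>2 - 5 * T ^ 3 * e + T ^ 3) - e ^ 5" if "e \<noteq> 0" for e
      using that T by (simp add: field_simps eval_nat_numeral)
    thus ?thesis by simp
  qed
  finally show ?thesis by simp
qed

text \<open>The five initial values U(F^m) for m = 0, -1, ..., -4. Only the class 0 sums of the X_i
  remain; they are polynomials in S = \<open>V5\<close> (1/t), which \<open>U5\<close> turns into
  polynomials in 1/t.\<close>

lemma U5_G_powers:
  "U5 (1 :: complex fls) = 1"
  "U5 rr.G = 1"
  "U5 (rr.G\<^sup>2) = - 2 * (1 / hauptmodul) - 5"
  "U5 (rr.G ^ 3) = 25"
  "U5 (rr.G ^ 4) = - 2 * (1 / hauptmodul)\<^sup>2 - 125"
proof -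
  define s where "s = 1 / hauptmodul"
  have S: "rr.S = V5 s" by (simp add: rr_S s_def fls_compose_power_1_divide)
  have V1: "V5 1 = (1 :: complex fls)" by simp
  have Vn: "V5 (numeral k) = (numeral k :: complex fls)" for k
    using fls_compose_power_const_left[of 5 "numeral k :: complex"] by simp
  show U1: "U5 (1 :: complex fls) = 1" using U5_V5[of "1 :: complex fls"] by simp
  define h where "h = rr.X1 + rr.X2 + rr.X3 + rr.X4"
  have G: "rr.G = 1 + h" by (simp add: rr.G_eq h_def)
  note P = U5_powers_graded[OF graded_rr_X, folded h_def]
  have Unum: "U5 (numeral k * f) = numeral k * U5 f" for k and f :: "complex fls"
    using U5_V5_mult[of "numeral k" f] by (simp add: Vn)
  have h2: "U5 (h\<^sup>2) = - 2 * (s + 3)"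
  proof -
    have "2 * (rr.X1 * rr.X4 + rr.X2 * rr.X3) = V5 (- 2 * (s + 3))"
      unfolding rr.X14 rr.X23 rr.S2 S by (simp add: Vn)
    thus ?thesis unfolding P(2) by (simp only: U5_V5)
  qed
  have h3: "U5 (h ^ 3) = 3 * (2 * s + 14)"
  proof -
    have "3 * (rr.X1\<^sup>2 * rr.X3 + rr.X2\<^sup>2 * rr.X1 + rr.X3\<^sup>2 * rr.X4 + rr.X4\<^sup>2 * rr.X2) = V5 (3 * (2 * s + 14))"
      unfolding rr.S3 S by (simp add: Vn)
    thus ?thesis unfolding P(3) by (simp only: U5_V5)
  qed
  have h4: "U5 (h ^ 4) = - 2 * s\<^sup>2 - 12 * s - 258"
  proof -
    have "rr.p\<^sup>2 + rr.r\<^sup>2 = (rr.p + rr.r)\<^sup>2 - 2 * (rr.p * rr.r)" by (simp add: algebra_simps power2_eq_square)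
    hence *: "rr.p\<^sup>2 + rr.r\<^sup>2 = (rr.S + 3)\<^sup>2 + 8" unfolding rr.S2 rr.pr power2_minus by simp
    have "6 * ((rr.X1 * rr.X4)\<^sup>2 + (rr.X2 * rr.X3)\<^sup>2) + 24 * ((rr.X1 * rr.X4) * (rr.X2 * rr.X3))
           + 4 * (rr.X1 ^ 3 * rr.X2 + rr.X2 ^ 3 * rr.X4 + rr.X3 ^ 3 * rr.X1 + rr.X4 ^ 3 * rr.X3)
        = 6 * ((rr.S + 3)\<^sup>2 + 8) + 24 * (- 4) + 4 * (- 2 * rr.S\<^sup>2 - 12 * rr.S - 66)"
      unfolding rr.S4 unfolding rr.X14 rr.X23 rr.pr * ..
    also have "\<dots> = - 2 * rr.S\<^sup>2 - 12 * rr.S - 258" by (simp add: algebra_simps power2_eq_square)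
    also have "\<dots> = V5 (- 2 * s\<^sup>2 - 12 * s - 258)" unfolding S by (simp add: Vn)
    finally show ?thesis unfolding P(4) by (simp only: U5_V5)
  qed
  show "U5 rr.G = 1" unfolding G by (simp add: U5_add U1 P(1))
  have "rr.G\<^sup>2 = 1 + 2 * h + h\<^sup>2" unfolding G by (simp add: algebra_simps power2_eq_square)
  hence "U5 (rr.G\<^sup>2) = - 2 * s - 5" by (simp add: U5_add U1 P(1) Unum h2)
  thus "U5 (rr.G\<^sup>2) = - 2 * (1 / hauptmodul) - 5" unfolding s_def .
  have "rr.G ^ 3 = 1 + 3 * h + 3 * h\<^sup>2 + h ^ 3" unfolding G by (simp add: algebra_simps eval_nat_numeral)
  thus "U5 (rr.G ^ 3) = 25" by (simp add: U5_add U1 P(1) Unum h2 h3)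
  have "rr.G ^ 4 = 1 + 4 * h + 6 * h\<^sup>2 + 4 * h ^ 3 + h ^ 4" unfolding G by (simp add: algebra_simps eval_nat_numeral)
  hence "U5 (rr.G ^ 4) = - 2 * s\<^sup>2 - 125" by (simp add: U5_add U1 P(1) Unum h2 h3 h4)
  thus "U5 (rr.G ^ 4) = - 2 * (1 / hauptmodul)\<^sup>2 - 125" unfolding s_def .
qed

subsection \<open>5-adic estimates\<close>

text \<open>
  With weight 3 for the prime 5, -5 for t and -3 for F, the first inequality says that U lowers
  the weight of F^m by at most 3 (in terms of t), and the second reflects the order
  3m of vanishing of F^m at q = 0.  Negative m are admitted because U(F^m) is simplest for
  -4 \<le> m \<le> 0, which suffices to start the recurrence of length 5.
\<close>

inductive_set lat :: "int \<Rightarrow> complex fls set" for m :: int where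
  lat_0: "0 \<in> lat m"
| lat_gen: "x \<in> lat m \<Longrightarrow> 5 * j - 3 * m \<le> 3 * int e + 3 \<Longrightarrow> 3 * m \<le> 5 * j
    \<Longrightarrow> x + of_int z * 5 ^ e * hauptmodul powi j \<in> lat m"

lemma lat_add: "y \<in> lat m \<Longrightarrow> x \<in> lat m \<Longrightarrow> x + y \<in> lat m"
proof (induction rule: lat.induct)
  case (lat_gen y j e z)
  have "(x + y) + of_int z * 5 ^ e * hauptmodul powi j \<in> lat m"
    by (rule lat.lat_gen) (use lat_gen in auto)
  thus ?case by (simp only: add.assoc)
qed simp

lemma lat_single:
  assumes "5 * j - 3 * m \<le> 3 * int e + 3" "3 * m \<le> 5 * j"
  shows "of_int z * 5 ^ e * hauptmodul powi j \<in> lat m"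
  using lat_gen[OF lat_0 assms, of z] by simp

text \<open>The multiplier obeys the inequalities of \<open>lat\<close> with slack 0 instead of 3,
  so adding the bounds reproduces the slack 3.\<close>

lemma lat_mult:
  assumes "x \<in> lat m" and k: "5 * int i - 3 * d \<le> 3 * int k" "3 * d \<le> 5 * int i"
  shows "of_int c * 5 ^ k * hauptmodul ^ i * x \<in> lat (m + d)"
  using assms(1)
proof (induction rule: lat.induct)
  case lat_0
  show ?case using lat.lat_0 by simp
next
  case (lat_gen x j e z)
  have "hauptmodul ^ i * hauptmodul powi j = hauptmodul powi (int i + j)"
    by (simp add: power_int_add)
  hence "of_int c * 5 ^ k * hauptmodul ^ i * (x + of_int z * 5 ^ e * hauptmodul powi j)
     = of_int c * 5 ^ k * hauptmodul ^ i * x + of_int (c * z) * 5 ^ (k + e) * hauptmodul powi (int i + j)"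
    by (simp add: algebra_simps power_add)
  moreover have "\<dots> \<in> lat (m + d)"
    by (rule lat.lat_gen) (use lat_gen k in auto)
  ultimately show ?case by simp
qed

lemma lat_uminus: "x \<in> lat m \<Longrightarrow> - x \<in> lat m"
  using lat_mult[of x m 0 0 0 "-1"] by simp

lemma lat_diff: "x \<in> lat m \<Longrightarrow> y \<in> lat m \<Longrightarrow> x - y \<in> lat m"
  using lat_add[OF lat_uminus] by fastforce

text \<open>The free factor g will be G^4 = F^(-4): this reaches the negative powers of F while all
  exponents stay natural numbers.\<close>

lemma U5_eta_quot_recurrence:
  "U5 (eta_quot ^ (n + 5) * g) = (15 * hauptmodul + 125 * hauptmodul\<^sup>2 + 625 * hauptmodul ^ 3) * U5 (eta_quot ^ (n + 4) * g)
    - (25 * hauptmodul\<^sup>2 + 125 * hauptmodul ^ 3) * U5 (eta_quot ^ (n + 3) * g)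
    + (5 * hauptmodul\<^sup>2 + 25 * hauptmodul ^ 3) * U5 (eta_quot ^ (n + 2) * g)
    - 5 * hauptmodul ^ 3 * U5 (eta_quot ^ (n + 1) * g) + hauptmodul ^ 3 * U5 (eta_quot ^ n * g)"
proof -
  have Vn: "V5 (numeral k) = (numeral k :: complex fls)" for k
    using fls_compose_power_const_left[of 5 "numeral k :: complex"] by simp
  have U5_diff: "U5 (f - g) = U5 f - U5 g" for f g :: "complex fls" by (simp add: fls_eq_iff)
  let ?a = "15 * hauptmodul + 125 * hauptmodul\<^sup>2 + 625 * hauptmodul ^ 3" and ?b = "25 * hauptmodul\<^sup>2 + 125 * hauptmodul ^ 3"
    and ?c = "5 * hauptmodul\<^sup>2 + 25 * hauptmodul ^ 3" and ?d = "5 * hauptmodul ^ 3"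
  have "eta_quot ^ (n + 5) * g = eta_quot ^ 5 * (eta_quot ^ n * g)" by (simp add: power_add mult_ac)
  also have "\<dots> = V5 ?a * (eta_quot ^ (n + 4) * g) - V5 ?b * (eta_quot ^ (n + 3) * g) + V5 ?c * (eta_quot ^ (n + 2) * g)
    - V5 ?d * (eta_quot ^ (n + 1) * g) + V5 (hauptmodul ^ 3) * (eta_quot ^ n * g)"
    unfolding eta_quot_modular_equation power_add by (simp add: Vn algebra_simps)
  finally show ?thesis by (simp only: U5_add U5_diff U5_V5_mult)
qed

text \<open>Concerns U(F^(n-4)). The slack 3 in \<open>lat\<close> is dictated by the initial
  values, several of which attain it: 1 at m = -1, 25 at m = -3, 125 at m = -4. Every coefficient of
  the recurrence meets the hypotheses of \<open>lat_mult\<close>, so the bounds propagate.\<close>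

lemma U5_eta_quot_G_lat: "U5 (eta_quot ^ n * rr.G ^ 4) \<in> lat (int n - 4)"
proof (induction n rule: less_induct)
  case (less n)
  have G: "eta_quot * rr.G = 1" by (simp add: eta_quot_eq)
  hence G': "eta_quot * (rr.G * x) = x" for x by (metis mult.assoc mult_1)
  have cancel: "eta_quot ^ 1 * rr.G ^ 4 = rr.G ^ 3" "eta_quot ^ 2 * rr.G ^ 4 = rr.G\<^sup>2"
    "eta_quot ^ 3 * rr.G ^ 4 = rr.G" "eta_quot ^ 4 * rr.G ^ 4 = 1"
    by (simp_all add: eval_nat_numeral mult.assoc G G')
  have s: "hauptmodul powi (- 1) = 1 / hauptmodul" "hauptmodul powi (- 2) = (1 / hauptmodul)\<^sup>2"
    by (simp_all add: power_int_minus field_simps)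
  consider "n = 0" | "n = 1" | "n = 2" | "n = 3" | "n = 4" | k where "n = k + 5"
    by (cases "n < 5") (fastforce, metis add.commute le_Suc_ex not_le)
  thus ?case
  proof cases
    case 1
    have "of_int (-2) * 5 ^ 0 * hauptmodul powi (-2) + of_int (-1) * 5 ^ 3 * hauptmodul powi 0 \<in> lat (-4)"
      by (intro lat_gen lat_single) auto
    thus ?thesis using 1 by (simp add: U5_G_powers s)
  next
    case 2
    have "of_int 1 * 5 ^ 2 * hauptmodul powi 0 \<in> lat (-3)"
      by (intro lat_single) auto
    thus ?thesis unfolding 2 cancel by (simp add: U5_G_powers)
  next
    case 3
    have "of_int (-2) * 5 ^ 0 * hauptmodul powi (-1) + of_int (-1) * 5 ^ 1 * hauptmodul powi 0 \<in> lat (-2)"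
      by (intro lat_gen lat_single) auto
    thus ?thesis unfolding 3 cancel by (simp add: U5_G_powers divide_inverse power_int_minus)
  next
    case 4
    have "of_int 1 * 5 ^ 0 * hauptmodul powi 0 \<in> lat (-1)"
      by (intro lat_single) auto
    thus ?thesis unfolding 4 cancel by (simp add: U5_G_powers)
  next
    case 5
    have "of_int 1 * 5 ^ 0 * hauptmodul powi 0 \<in> lat 0"
      by (intro lat_single) auto
    thus ?thesis unfolding 5 cancel by (simp add: U5_G_powers)
  next
    case 6
    define y where "y = (\<lambda>i. U5 (eta_quot ^ (k + i) * rr.G ^ 4))"
    have y: "y i \<in> lat (int k + int i - 4)" if "i < 5" for i
      using less.IH[of "k + i"] that 6 by (simp add: y_def)
    have eq: "U5 (eta_quot ^ n * rr.G ^ 4)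
      = (of_int 3 * 5 ^ 1 * hauptmodul ^ 1 * y 4 + of_int 1 * 5 ^ 3 * hauptmodul ^ 2 * y 4 + of_int 1 * 5 ^ 4 * hauptmodul ^ 3 * y 4)
      - (of_int 1 * 5 ^ 2 * hauptmodul ^ 2 * y 3 + of_int 1 * 5 ^ 3 * hauptmodul ^ 3 * y 3)
      + (of_int 1 * 5 ^ 1 * hauptmodul ^ 2 * y 2 + of_int 1 * 5 ^ 2 * hauptmodul ^ 3 * y 2)
      - of_int 1 * 5 ^ 1 * hauptmodul ^ 3 * y 1 + of_int 1 * 5 ^ 0 * hauptmodul ^ 3 * y 0"
      unfolding 6 U5_eta_quot_recurrence y_def by (simp add: algebra_simps)
    have m: "of_int c * 5 ^ e * hauptmodul ^ j * y i \<in> lat (int n - 4)"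
      if "i < 5" "5 * int j - 3 * (5 - int i) \<le> 3 * int e" "3 * (5 - int i) \<le> 5 * int j" for c e j i
    proof -
      have "of_int c * 5 ^ e * hauptmodul ^ j * y i \<in> lat (int k + int i - 4 + (5 - int i))"
        by (rule lat_mult[OF y]) (use that in auto)
      thus ?thesis by (simp add: 6)
    qed
    show ?thesis unfolding eq
      by (intro lat_add lat_diff m) simp_all
  qed
qed

lemma U5_eta_quot_lat: "U5 (eta_quot ^ n) \<in> lat (int n)"
proof -
  have "eta_quot * rr.G = 1" by (simp add: eta_quot_eq)
  hence "eta_quot ^ 4 * rr.G ^ 4 = 1" by (metis power_mult_distrib power_one)
  hence "eta_quot ^ (n + 4) * rr.G ^ 4 = eta_quot ^ n" by (simp add: power_add mult.assoc)
  with U5_eta_quot_G_lat[of "n + 4"] show ?thesis by simp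
qed

text \<open>The span from the end of the overview. The constant 7 is what x \<mapsto> U(F x)
  reproduces: in the critical case j = 1, w = 0 the estimate is exactly 5k \<le> 3e + 7 for the new
  exponents.\<close>

inductive_set fmod :: "complex fls set" where
  fmod_0: "0 \<in> fmod"
| fmod_gen: "x \<in> fmod \<Longrightarrow> j \<ge> 1 \<Longrightarrow> 5 * j \<le> 3 * w + 7 \<Longrightarrow> x + of_int z * 5 ^ w * hauptmodul ^ j \<in> fmod"

lemma fmod_add: "y \<in> fmod \<Longrightarrow> x \<in> fmod \<Longrightarrow> x + y \<in> fmod"
proof (induction rule: fmod.induct)
  case (fmod_gen y j w z)
  have "(x + y) + of_int z * 5 ^ w * hauptmodul ^ j \<in> fmod"
    by (rule fmod.fmod_gen) (use fmod_gen in auto)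
  thus ?case by (simp only: add.assoc)
qed simp

lemma lat_shift_odd:
  assumes "x \<in> lat (2 * int j + 1)" and "j = 0 \<or> 5 * j \<le> 3 * w + 7"
  shows "of_int z * 5 ^ w * (x * hauptmodul powi (- int j)) \<in> fmod"
  using assms(1)
proof (induction rule: lat.induct)
  case lat_0
  show ?case using fmod.fmod_0 by simp
next
  case (lat_gen x i e c)
  define k where "k = nat (i - int j)"
  have k: "int k = i - int j" using lat_gen by (auto simp: k_def)
  have "hauptmodul powi i * hauptmodul powi (- int j) = hauptmodul powi (int k)"
    unfolding k by (simp flip: power_int_add)
  also have "\<dots> = hauptmodul ^ k" by simp
  finally have "hauptmodul powi i * hauptmodul powi (- int j) = hauptmodul ^ k" .
  hence "of_int z * 5 ^ w * ((x + of_int c * 5 ^ e * hauptmodul powi i) * hauptmodul powi (- int j))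
    = of_int z * 5 ^ w * (x * hauptmodul powi (- int j)) + of_int (z * c) * 5 ^ (w + e) * hauptmodul ^ k"
    by (simp add: algebra_simps power_add)
  also have "\<dots> \<in> fmod"
  proof (rule fmod.fmod_gen)
    show "of_int z * 5 ^ w * (x * hauptmodul powi (- int j)) \<in> fmod" by (rule lat_gen)
    have "int j \<ge> 0" by simp
    hence "i > int j" using lat_gen(3) by simp
    thus "k \<ge> 1" using k by simp
    have "5 * int k \<le> 3 * int (w + e) + 7"
    proof -
      have k5: "5 * int k \<le> 3 * int e + 6 + int j" using lat_gen(2) k by (simp add: algebra_simps)
      \<comment> \<open>For j \<le> 1 the bound is immediate; for j \<ge> 2 the assumption 5j \<le>
        3w + 7 absorbs j into 3w.\<close>
      from assms(2) consider "int j \<le> 1" | "int j \<ge> 2" "5 * int j \<le> 3 * int w + 7" by linarith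
      thus ?thesis using k5 by cases simp_all
    qed
    thus "5 * k \<le> 3 * (w + e) + 7" by linarith
  qed
  finally show ?case .
qed

text \<open>Serves U(t^j) = U(F^(2j)) t^(-j). Now 5k \<le> 3e + 3 + j, better by 3 than in the odd
  case, and this pays for the factor 5.\<close>

lemma lat_shift_even:
  assumes "x \<in> lat (2 * int j)" and "j \<ge> 1" "5 * j \<le> 3 * w + 7"
  shows "\<exists>y\<in>fmod. of_int z * 5 ^ w * (x * hauptmodul powi (- int j)) = 5 * y"
  using assms(1)
proof (induction rule: lat.induct)
  case lat_0
  show ?case using fmod.fmod_0 by (intro bexI[of _ 0]) auto
next
  case (lat_gen x i e c)
  from lat_gen.IH obtain y where y: "y \<in> fmod" "of_int z * 5 ^ w * (x * hauptmodul powi (- int j)) = 5 * y" by blast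
  define k where "k = nat (i - int j)"
  have k: "int k = i - int j" using lat_gen by (auto simp: k_def)
  have k1: "k \<ge> 1" using lat_gen k assms by linarith
  \<comment> \<open>A factor 5 is really present: j = 1 and k \<ge> 1 force e \<ge> 1, while j \<ge>
    2 forces w \<ge> 1.\<close>
  obtain v where v: "w + e = Suc v" using lat_gen k k1 assms by (cases "w + e") auto
  have "hauptmodul powi i * hauptmodul powi (- int j) = hauptmodul powi (int k)"
    unfolding k by (simp flip: power_int_add)
  also have "\<dots> = hauptmodul ^ k" by simp
  finally have "hauptmodul powi i * hauptmodul powi (- int j) = hauptmodul ^ k" .
  hence "of_int z * 5 ^ w * ((x + of_int c * 5 ^ e * hauptmodul powi i) * hauptmodul powi (- int j))
    = of_int z * 5 ^ w * (x * hauptmodul powi (- int j)) + of_int (z * c) * 5 ^ (w + e) * hauptmodul ^ k"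
    by (simp add: algebra_simps power_add)
  also have "\<dots> = 5 * (y + of_int (z * c) * 5 ^ v * hauptmodul ^ k)"
    unfolding y(2) v by (simp add: algebra_simps)
  finally show ?case
  proof (rule bexI)
    show "y + of_int (z * c) * 5 ^ v * hauptmodul ^ k \<in> fmod"
      by (rule fmod.fmod_gen[OF y(1) k1]) (use lat_gen k v assms in linarith)
  qed
qed

text \<open>F^2 = t \<open>V5\<close> t gives t^j = F^(2j) \<open>V5\<close> (t^(-j)), and the last
  factor leaves \<open>U5\<close> as t^(-j).\<close>

lemma U5_hauptmodul_power:
  "U5 (eta_quot ^ i * hauptmodul ^ j) = U5 (eta_quot ^ (2 * j + i)) * hauptmodul powi (- int j)"
proof -
  have "hauptmodul = eta_quot\<^sup>2 * V5 (1 / hauptmodul)"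
    using eta_quot_squared by (simp add: fls_compose_power_1_divide)
  hence "hauptmodul ^ j = (eta_quot\<^sup>2 * V5 (1 / hauptmodul)) ^ j" by simp
  also have "\<dots> = eta_quot ^ (2 * j) * V5 ((1 / hauptmodul) ^ j)" by (simp add: power_mult_distrib power_mult)
  also have "(1 / hauptmodul) ^ j = hauptmodul powi (- int j)" by (simp add: power_int_minus field_simps)
  finally have "eta_quot ^ i * hauptmodul ^ j = eta_quot ^ (2 * j + i) * V5 (hauptmodul powi (- int j))"
    by (simp add: power_add mult_ac)
  thus ?thesis by (simp add: U5_mult_V5)
qed

lemma U5_monom_mult: "U5 (of_int z * 5 ^ w * f) = of_int z * 5 ^ w * U5 f" for f :: "complex fls"
proof -
  have "V5 5 = (5 :: complex fls)"
    using fls_compose_power_const_left[of 5 "5 :: complex"] by simp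
  hence "V5 (of_int z * 5 ^ w) = (of_int z * 5 ^ w :: complex fls)"
    by (simp add: fls_of_int)
  thus ?thesis using U5_V5_mult[of "of_int z * 5 ^ w" f] by simp
qed

lemma U5_eta_quot_fmod: "U5 eta_quot \<in> fmod"
  using lat_shift_odd[of "U5 eta_quot" 0 0 1] U5_eta_quot_lat[of 1] by simp

lemma U5_eta_quot_mult_fmod: "x \<in> fmod \<Longrightarrow> U5 (eta_quot * x) \<in> fmod"
proof (induction rule: fmod.induct)
  case (fmod_gen x j w z)
  have "U5 (eta_quot * (x + of_int z * 5 ^ w * hauptmodul ^ j)) = U5 (eta_quot * x) + U5 (of_int z * 5 ^ w * (eta_quot ^ 1 * hauptmodul ^ j))"
    by (simp add: distrib_left U5_add mult_ac)
  also have "\<dots> = U5 (eta_quot * x) + of_int z * 5 ^ w * (U5 (eta_quot ^ (2 * j + 1)) * hauptmodul powi (- int j))"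
    unfolding U5_monom_mult U5_hauptmodul_power ..
  also have "\<dots> \<in> fmod"
    using fmod_gen U5_eta_quot_lat[of "2 * j + 1"] by (intro fmod_add lat_shift_odd) (auto simp: add_ac)
  finally show ?case .
qed (simp add: fmod.fmod_0)

lemma U5_fmod: "x \<in> fmod \<Longrightarrow> \<exists>y\<in>fmod. U5 x = 5 * y"
proof (induction rule: fmod.induct)
  case fmod_0
  show ?case using fmod.fmod_0 by (intro bexI[of _ 0]) auto
next
  case (fmod_gen x j w z)
  have "U5 (eta_quot ^ (2 * j)) \<in> lat (2 * int j)" using U5_eta_quot_lat[of "2 * j"] by simp
  from lat_shift_even[OF this] fmod_gen obtain y where
    y: "y \<in> fmod" "of_int z * 5 ^ w * (U5 (eta_quot ^ (2 * j)) * hauptmodul powi (- int j)) = 5 * y" by blast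
  from fmod_gen obtain x' where x': "x' \<in> fmod" "U5 x = 5 * x'" by blast
  have "U5 (x + of_int z * 5 ^ w * hauptmodul ^ j) = U5 x + of_int z * 5 ^ w * U5 (eta_quot ^ 0 * hauptmodul ^ j)"
    by (simp add: U5_add U5_monom_mult)
  also have "\<dots> = 5 * x' + 5 * y" unfolding U5_hauptmodul_power x' using y(2) by simp
  also have "\<dots> = 5 * (x' + y)" by (simp add: algebra_simps)
  finally show ?case using fmod_add[OF y(1) x'(1)] by blast
qed

subsection \<open>Cubic partitions\<close>

definition map_int :: "int fps \<Rightarrow> 'a::comm_ring_1 fps" where
  "map_int f = Abs_fps (\<lambda>n. of_int (f $ n))"

lemma map_int_nth [simp]: "map_int f $ n = of_int (f $ n)"
  by (simp add: map_int_def)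

lemma map_int_mult: "map_int (f * g) = map_int f * map_int g"
  by (rule fps_ext) (simp add: fps_mult_nth)

lemma map_int_1 [simp]: "map_int 1 = 1"
  by (rule fps_ext) simp

lemma map_int_prod: "map_int (\<Prod>k\<in>A. f k) = (\<Prod>k\<in>A. map_int (f k))"
  by (induction A rule: infinite_finite_induct) (auto simp: map_int_mult)

lemma map_int_1_minus_X_power: "map_int (1 - fps_X ^ k) = 1 - fps_X ^ k"
  by (rule fps_ext) (simp add: fps_X_power_nth)

definition geo :: "nat \<Rightarrow> int fps" where
  "geo k = Abs_fps (\<lambda>n. if k dvd n then 1 else 0)"

lemma geo_inverse: "k > 0 \<Longrightarrow> geo k * (1 - fps_X ^ k) = 1"
  by (rule fps_ext)
     (auto simp: geo_def right_diff_distrib fps_X_power_mult_right_nth not_less dvd_minus_self dest: dvd_imp_le)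

text \<open>An integral version of the rational \<open>cubic_gf\<close>: it provides the integer
  that the definite description in \<open>cubic_partition\<close> refers to.\<close>

definition cubic_int :: "nat \<Rightarrow> int fps" where
  "cubic_int N = (\<Prod>k\<in>{1..N}. geo k * geo (2 * k))"

lemma cubic_int_inverse:
  "map_int (cubic_int N) * (\<Prod>k\<in>{1..N}. (1 - fps_X ^ k) * (1 - fps_X ^ (2 * k))) = (1 :: 'a::comm_ring_1 fps)"
proof -
  have "cubic_int N * (\<Prod>k\<in>{1..N}. (1 - fps_X ^ k) * (1 - fps_X ^ (2 * k))) = 1"
    unfolding cubic_int_def prod.distrib[symmetric]
  proof (rule prod.neutral, rule ballI)
    fix k assume "k \<in> {1..N}"
    hence k: "geo k * (1 - fps_X ^ k) = 1" "geo (2 * k) * (1 - fps_X ^ (2 * k)) = 1"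
      by (auto intro!: geo_inverse)
    have "geo k * geo (2 * k) * ((1 - fps_X ^ k) * (1 - fps_X ^ (2 * k)))
        = (geo k * (1 - fps_X ^ k)) * (geo (2 * k) * (1 - fps_X ^ (2 * k)))" by (simp only: mult_ac)
    thus "geo k * geo (2 * k) * ((1 - fps_X ^ k) * (1 - fps_X ^ (2 * k))) = 1" unfolding k by simp
  qed
  from arg_cong[OF this, of "map_int :: _ \<Rightarrow> 'a fps"] show ?thesis
    by (simp add: map_int_mult map_int_prod map_int_1_minus_X_power)
qed

lemma cubic_gf_eq: "cubic_gf N = map_int (cubic_int N)"
proof -
  define P :: "rat fps" where "P = (\<Prod>k\<in>{1..N}. (1 - fps_X ^ k) * (1 - fps_X ^ (2 * k)))"
  have "cubic_gf N * P = (\<Prod>k\<in>{1..N}. 1)"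
    unfolding cubic_gf_def P_def prod.distrib[symmetric]
    by (intro prod.cong refl inverse_mult_eq_1) (auto simp: fps_X_power_nth)
  hence "cubic_gf N * P = map_int (cubic_int N) * P"
    unfolding P_def cubic_int_inverse by simp
  moreover have "P \<noteq> 0" using cubic_int_inverse[of N, where ?'a = rat] unfolding P_def[symmetric]
    by (metis mult_zero_right zero_neq_one)
  ultimately show ?thesis by simp
qed

lemma cubic_partition_eq: "cubic_partition n = cubic_int n $ n"
  unfolding cubic_partition_def cubic_gf_eq by simp

lemma eqmod_cubic_int: "n \<le> N \<Longrightarrow> eqmod n (cubic_int N) (cubic_int n)"
proof (induction N rule: dec_induct)
  case (step N)
  have g: "eqmod n (geo k) 1" if "n < k" for k
    using that by (auto simp: eqmod_def geo_def dest: dvd_imp_le)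
  have "eqmod n (cubic_int N * (geo (Suc N) * geo (2 * Suc N))) (cubic_int n * (1 * 1))"
    by (intro eqmod_mult g step.IH) (use step in auto)
  thus ?case by (simp add: cubic_int_def)
qed simp

definition cubic_fps :: "complex fps" where
  "cubic_fps = Abs_fps (\<lambda>n. of_int (cubic_partition n))"

lemma cubic_fps_inverse: "cubic_fps * (euler * (euler oo fps_X ^ 2)) = 1"
proof (rule eqmod_imp_eq)
  fix n
  have "eqmod n cubic_fps (map_int (cubic_int n))"
    unfolding eqmod_def
  proof (intro allI impI)
    fix i assume "i \<le> n"
    hence "cubic_int n $ i = cubic_int i $ i" using eqmod_cubic_int[of i n] by (simp add: eqmod_def)
    thus "cubic_fps $ i = map_int (cubic_int n) $ i" by (simp add: cubic_fps_def cubic_partition_eq)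
  qed
  moreover have e: "eqmod n euler (euler_trunc n)" by (rule eqmod_euler) simp
  ultimately have "eqmod n (cubic_fps * (euler * (euler oo fps_X ^ 2)))
     (map_int (cubic_int n) * (euler_trunc n * (euler_trunc n oo fps_X ^ 2)))"
    by (intro eqmod_mult eqmod_compose_X_power) simp_all
  also have "euler_trunc n * (euler_trunc n oo fps_X ^ 2)
      = (\<Prod>k\<in>{1..n}. (1 - fps_X ^ k) * (1 - fps_X ^ (2 * k)) :: complex fps)"
    by (subst euler_trunc_compose) (simp_all add: euler_trunc_def prod.distrib)
  finally show "eqmod n (cubic_fps * (euler * (euler oo fps_X ^ 2))) 1"
    unfolding cubic_int_inverse .
qed

definition cubic_fls :: "complex fls" where "cubic_fls = fps_to_fls cubic_fps"

lemma cubic_fls_eq: "cubic_fls = 1 / (euler_fls 1 * euler_fls 2)"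
proof -
  have "cubic_fls * (euler_fls 1 * euler_fls 2) = 1"
    using arg_cong[OF cubic_fps_inverse, of fps_to_fls]
    by (simp add: cubic_fls_def euler_fls_def fls_times_fps_to_fls)
  thus ?thesis by (simp add: eq_divide_eq)
qed

text \<open>Over the complex numbers a factor 5^n says nothing about divisibility until the cofactor
  is known to have integer coefficients.\<close>

definition integral_fls :: "complex fls \<Rightarrow> bool" where
  "integral_fls f \<longleftrightarrow> (\<forall>n. f $$ n \<in> \<int>)"

lemma integral_fls_add [intro]: "integral_fls f \<Longrightarrow> integral_fls g \<Longrightarrow> integral_fls (f + g)"
  by (auto simp: integral_fls_def)

lemma integral_fls_mult [intro]: "integral_fls f \<Longrightarrow> integral_fls g \<Longrightarrow> integral_fls (f * g)"
  by (auto simp: integral_fls_def fls_times_nth(2) intro!: Ints_sum)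

lemma integral_fls_of_int [intro]: "integral_fls (of_int z)"
  by (auto simp: integral_fls_def fls_of_int)

lemma integral_fls_power [intro]: "integral_fls f \<Longrightarrow> integral_fls (f ^ n)"
  using integral_fls_of_int[of 1] by (induction n) auto

lemma integral_fls_X: "integral_fls fls_X"
  by (auto simp: integral_fls_def)

lemma integral_euler_fls: "integral_fls (euler_fls k)"
proof -
  have "(euler :: complex fps) $ n \<in> \<int>" for n
    by (auto simp: euler_pentagonal alt_sign_def intro!: Ints_sum)
  hence "(euler oo fps_X ^ k :: complex fps) $ n \<in> \<int>" for n
    unfolding fps_compose_nth by (cases "k = 0") (auto intro!: Ints_sum Ints_mult simp: fps_X_power_nth simp flip: power_mult)
  thus ?thesis by (auto simp: integral_fls_def euler_fls_def)
qed

lemma integral_cubic_fls: "integral_fls cubic_fls"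
  by (auto simp: integral_fls_def cubic_fls_def cubic_fps_def)

lemma integral_hauptmodul: "integral_fls hauptmodul"
proof -
  have *: "hauptmodul = fls_X * (euler_fls 5 * euler_fls 10)\<^sup>2 * cubic_fls\<^sup>2"
    by (simp add: hauptmodul_def cubic_fls_eq power_divide)
  show ?thesis unfolding *
    by (intro integral_fls_mult integral_fls_power integral_fls_X integral_euler_fls integral_cubic_fls)
qed

lemma integral_fmod: "x \<in> fmod \<Longrightarrow> integral_fls x"
proof (induction rule: fmod.induct)
  case (fmod_gen x j w z)
  have "of_int z * 5 ^ w * hauptmodul ^ j = of_int (z * 5 ^ w) * hauptmodul ^ j" by simp
  moreover have "integral_fls (x + of_int (z * 5 ^ w) * hauptmodul ^ j)"
    by (intro integral_fls_add integral_fls_mult integral_fls_of_int integral_fls_power integral_hauptmodul fmod_gen)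
  ultimately show ?case by simp
qed (simp add: integral_fls_def)

section \<open>Iterating U(U(q^3 x)) on the generating function\<close>

primrec cubic_iter :: "nat \<Rightarrow> complex fls" where
  "cubic_iter 0 = cubic_fls"
| "cubic_iter (Suc n) = U5 (U5 (fls_X ^ 3 * cubic_iter n))"

text \<open>F f_1 f_2 = q^3 f_25 f_50, and f_25 f_50 is f_1 f_2 at q^25; each of the two operators
  \<open>U5\<close> undoes one substitution q \<mapsto> q^5.\<close>

lemma euler_cubic_iter_Suc:
  "euler_fls 1 * euler_fls 2 * cubic_iter (Suc n) = U5 (U5 (eta_quot * (euler_fls 1 * euler_fls 2 * cubic_iter n)))"
proof -
  have V: "euler_fls 25 * euler_fls 50 = V5 (euler_fls 5 * euler_fls 10)"
    "euler_fls 5 * euler_fls 10 = V5 (euler_fls 1 * euler_fls 2)"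
    by (simp_all add: euler_fls_compose)
  have "eta_quot * (euler_fls 1 * euler_fls 2 * cubic_iter n) = V5 (euler_fls 5 * euler_fls 10) * (fls_X ^ 3 * cubic_iter n)"
    unfolding eta_quot_def V(1)[symmetric] by simp
  hence "U5 (eta_quot * (euler_fls 1 * euler_fls 2 * cubic_iter n)) = V5 (euler_fls 1 * euler_fls 2) * U5 (fls_X ^ 3 * cubic_iter n)"
    unfolding V(2)[symmetric] by (simp only: U5_V5_mult)
  thus ?thesis by (simp only: U5_V5_mult cubic_iter.simps)
qed

lemma cubic_iter_fmod: "\<exists>y\<in>fmod. euler_fls 1 * euler_fls 2 * cubic_iter (Suc n) = 5 ^ Suc n * y"
proof (induction n)
  case 0
  have "euler_fls 1 * euler_fls 2 * cubic_iter 0 = 1" by (simp add: cubic_fls_eq)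
  hence "euler_fls 1 * euler_fls 2 * cubic_iter (Suc 0) = U5 (U5 eta_quot)"
    unfolding euler_cubic_iter_Suc by simp
  thus ?case using U5_fmod[OF U5_eta_quot_fmod] by simp
next
  case (Suc n)
  then obtain y where y: "y \<in> fmod" "euler_fls 1 * euler_fls 2 * cubic_iter (Suc n) = 5 ^ Suc n * y" by blast
  from U5_fmod[OF U5_eta_quot_mult_fmod[OF y(1)]] obtain z where z: "z \<in> fmod" "U5 (U5 (eta_quot * y)) = 5 * z" by blast
  have "euler_fls 1 * euler_fls 2 * cubic_iter (Suc (Suc n)) = U5 (U5 (of_int 1 * 5 ^ Suc n * (eta_quot * y)))"
    unfolding euler_cubic_iter_Suc[of "Suc n"] y(2) by (simp add: mult_ac)
  also have "\<dots> = 5 ^ Suc (Suc n) * z"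
    unfolding U5_monom_mult z by (simp add: mult_ac)
  finally show ?case using z(1) by blast
qed

lemma cubic_iter_nth_dvd: "\<exists>z. cubic_iter (Suc n) $$ k = of_int (5 ^ Suc n * z)"
proof -
  from cubic_iter_fmod[of n] obtain y where
    y: "y \<in> fmod" "euler_fls 1 * euler_fls 2 * cubic_iter (Suc n) = 5 ^ Suc n * y" by blast
  have "cubic_iter (Suc n) = cubic_fls * (euler_fls 1 * euler_fls 2 * cubic_iter (Suc n))"
    unfolding cubic_fls_eq by simp
  also have "\<dots> = 5 ^ Suc n * (cubic_fls * y)" unfolding y(2) by (simp only: mult_ac)
  also have "\<dots> = of_int (5 ^ Suc n) * (cubic_fls * y)" by simp
  finally have "cubic_iter (Suc n) $$ k = of_int (5 ^ Suc n) * (cubic_fls * y) $$ k"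
    by (simp only: fls_mult_of_int_nth)
  moreover have "(cubic_fls * y) $$ k \<in> \<int>"
    using integral_fls_mult[OF integral_cubic_fls integral_fmod[OF y(1)]] by (simp add: integral_fls_def)
  then obtain z where "(cubic_fls * y) $$ k = of_int z" by (elim Ints_cases)
  ultimately have "cubic_iter (Suc n) $$ k = of_int (5 ^ Suc n * z)" by simp
  thus ?thesis by blast
qed

text \<open>One iteration reads the coefficient at 25k - 3, so the shifts accumulate to c = 3 (1 +
  25 + ... + 25^(n-1)).\<close>

lemma cubic_iter_nth:
  assumes "8 * c = 25 ^ n - (1 :: int)"
  shows "cubic_iter n $$ k = cubic_fls $$ (25 ^ n * k - c)"
  using assms
proof (induction n arbitrary: k c)
  case (Suc n)
  have "8 * (c - 3 * 25 ^ n) = 25 ^ n - (1 :: int)" using Suc.prems by simp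
  hence "cubic_iter n $$ (25 * k - 3) = cubic_fls $$ (25 ^ n * (25 * k - 3) - (c - 3 * 25 ^ n))" by (rule Suc.IH)
  also have "25 ^ n * (25 * k - 3) - (c - 3 * 25 ^ n) = 25 ^ Suc n * k - c" by (simp add: algebra_simps)
  also have "cubic_iter n $$ (25 * k - 3) = cubic_iter (Suc n) $$ k"
    by (simp add: fls_X_power_times_conv_shift)
  finally show ?case .
qed simp

theorem theorem1p4:
  fixes \<alpha> n :: nat and \<delta> :: int
  assumes "0 \<le> \<delta>" and "\<delta> < 5 ^ (2 * \<alpha> + 2)"
    and "[8 * \<delta> = 1] (mod 5 ^ (2 * \<alpha> + 2))"
  shows "[cubic_partition (5 ^ (2 * \<alpha> + 2) * n + nat \<delta>) = 0] (mod 5 ^ (\<alpha> + 1))"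
proof -
  define M :: int where "M = 25 ^ Suc \<alpha>"
  have M: "5 ^ (2 * \<alpha> + 2) = M"
    using power_mult[of "5 :: int" 2 "Suc \<alpha>"] by (simp add: M_def)
  obtain q where q: "8 * \<delta> - 1 = M * q"
    using assms(3) unfolding M by (auto simp: cong_iff_dvd_diff)
  \<comment> \<open>The bounds on \<delta> leave only q = 7: as M \<equiv> 1 modulo 8, q \<equiv>
    -1, and -1 \<le> q < 8, where q = -1 would make \<delta> negative.\<close>
  have "M mod 8 = 1" unfolding M_def by (subst power_mod[symmetric]) simp
  hence "q mod 8 = (M * q) mod 8" by (metis mod_mult_left_eq mult_1)
  also have "(M * q) mod 8 = 7" unfolding q[symmetric] by presburger
  finally have q8: "q mod 8 = 7" .
  have Mpos: "M > 0" by (simp add: M_def)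
  have "M * q < M * 8" using assms(2) q unfolding M by simp
  hence "q < 8" using Mpos by simp
  moreover have "q \<ge> -1"
  proof (rule ccontr)
    assume "\<not> q \<ge> -1"
    hence "M * q \<le> M * (-2)" using Mpos by (intro mult_left_mono) auto
    moreover have "M \<ge> 25" by (simp add: M_def)
    ultimately show False using assms(1) q by linarith
  qed
  moreover have "q \<noteq> -1"
  proof
    assume "q = -1"
    hence "8 * \<delta> = 1 - M" using q by simp
    moreover have "M \<ge> 25" by (simp add: M_def)
    ultimately show False using assms(1) by linarith
  qed
  ultimately have "q = 7" using q8 by presburger
  \<comment> \<open>M - \<delta> = (M - 1)/8 is the shift c of
    \<open>cubic_iter_nth\<close>.\<close>
  hence d: "8 * (M - \<delta>) = M - 1" using q by simp
  define N where "N = 5 ^ (2 * \<alpha> + 2) * n + nat \<delta>"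
  \<comment> \<open>The shift is subtracted, so the iterate must be read at n + 1 and not at
    n.\<close>
  have N: "int N = M * (int n + 1) - (M - \<delta>)"
  proof -
    have "int (5 ^ (2 * \<alpha> + 2)) = M" unfolding M[symmetric] by simp
    thus ?thesis using assms(1) by (simp only: N_def of_nat_add of_nat_mult) (simp add: algebra_simps)
  qed
  have "cubic_iter (Suc \<alpha>) $$ (int n + 1) = cubic_fls $$ (M * (int n + 1) - (M - \<delta>))"
    using cubic_iter_nth[of "M - \<delta>" "Suc \<alpha>" "int n + 1"] d unfolding M_def by blast
  also have "\<dots> = of_int (cubic_partition N)"
    unfolding N[symmetric] by (simp add: cubic_fls_def cubic_fps_def)
  finally obtain z where "of_int (cubic_partition N) = (of_int (5 ^ Suc \<alpha> * z) :: complex)"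
    using cubic_iter_nth_dvd[of \<alpha> "int n + 1"] by metis
  hence "cubic_partition N = 5 ^ Suc \<alpha> * z" by (simp only: of_int_eq_iff)
  thus ?thesis by (simp add: N_def cong_0_iff)
qed

end
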